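(* Let $I\subset\mathbb{R}$ be an open interval and consider a scalar autonomous second-order differential equation $$\frac{d^2x}{dt^2}=X\left(x,\frac{dx}{dt}\right),\qquad X\in C^\infty(I\times\mathbb{R}). \tag{E}$$ (i) Equation (E) is fibre-linearisable by a generalised Sundman transformation $y=\varphi(x)$, $d\tau=h(x)\,dt$ if, and only if, it is of the form $$\frac{d^2x}{dt^2}+\gamma(x)\left(\frac{dx}{dt}\right)^2+A(x)\frac{dx}{dt}+b(x)=0 \tag{F}$$ for some functions $\gamma,A,b\in C^\infty(I)$. Moreover, if on $I$ the function $A$ is either identically zero or nowhere vanishing, an equation of the form (F) can always be transformed by a generalised Sundman transformation into one of the form $$\frac{d^2y}{d\tau^2}+\alpha\,\frac{dy}{d\tau}+\beta(y)=0,$$ where $\beta$ is a smooth function and $\alpha=\operatorname{sign}(A)\in\{-1,0,1\}$ is the constant sign of $A$ (with $\alpha=0$ if $A\equiv 0$). (ii) Assume that whenever (E) is of the form (F), on $I$ the function $A$ is either identically zero or nowhere vanishing and, when $A\equiv0$, the function $b$ is either identically zero or nowhere vanishing. Then (E) is linearisable under generalised Sundman transformations if and only if it is of the form (F) and the coefficients $\gamma,A,b$ satisfy $$Q\equiv\left(A\frac{d}{dx}-3A'\right)\left(A\frac{d}{dx}+\gamma A-A'\right)b=0 \quad\text{on } I. \tag{L}$$ More specifically: - If $A= 0$ and $b= 0$, then (F) is transformed into $\dfrac{d^2y}{d\tau^2}=0$ by the transformation $y=x$, $\ d\tau=\exp\left(-\int^x\gamma(\zeta)\,d\zeta\right)dt$.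 - If $A= 0$ and $b\neq 0$, then (F) is transformed into $\dfrac{d^2y}{d\tau^2}+1=0$ by the transformation $$y=\int^x b(\zeta)\exp\left(2\int^\zeta\gamma(\eta)\,d\eta\right)d\zeta,\qquad d\tau=|b(x)|\exp\left(\int^x\gamma(\zeta)\,d\zeta\right)dt.$$ - If $A\neq 0$ and (L) is satisfied, then (F) is transformed into $\dfrac{d^2y}{d\tau^2}+\alpha\dfrac{dy}{d\tau}+By+C=0$, for some real constants $B,C$ and with $\alpha=\operatorname{sign}(A)$, by the transformation $$y=\int^x A(\zeta)\exp\left(\int^\zeta\gamma(\eta)\,d\eta\right)d\zeta,\qquad d\tau=|A(x)|\,dt.$$ In these formulas one and the same primitive of $\gamma$ is used throughout each transformation.
   Context: A generalised Sundman transformation on an open interval $I\subset\mathbb{R}$ is a pair $(h,\varphi)$, written $y=\varphi(x)$, $d\tau=h(x)\,dt$, where $h\in C^\infty(I)$ is a nowhere-vanishing (hence constant-sign) function and $\varphi:I\to\varphi(I)\subset\mathbb{R}$ is a smooth diffeomorphism onto an open interval. It sends a curve $x(t)$ in $I$ to the curve $y(\tau)$ determined by $y(\tau(t))=\varphi(x(t))$, where $d\tau/dt=h(x(t))$. It transforms the equation $\ddot x=X(x,\dot x)$ on $I$ into the equation $d^2y/d\tau^2=Y(y,dy/d\tau)$ on $\varphi(I)$ if it maps solutions of the former to solutions of the latter; equivalently, with $k=\varphi'/h$, $$Y\big(\varphi(x),k(x)v\big)=\frac1{h(x)}\left(k'(x)\,v^2+k(x)\,X(x,v)\right)\quad\text{for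 all }(x,v)\in I\times\mathbb{R}.$$ An equation is fibre-linearisable (linearisable in velocities) under generalised Sundman transformations if some generalised Sundman transformation transforms it into an equation of the form $y''+\mathcal{A}(y)\,y'+\mathcal{B}(y)=0$ with $\mathcal{A},\mathcal{B}$ smooth real functions. It is linearisable under generalised Sundman transformations if some generalised Sundman transformation transforms it into an equation of the form $y''+\alpha y'+By+C=0$ with real constants $\alpha,B,C$. (Primes on $y$ denote derivatives with respect to $\tau$.) Primes on functions of $x$ denote $d/dx$; the operator $A\frac{d}{dx}-3A'$ sends a function $g$ to $Ag'-3A'g$, and $A\frac{d}{dx}+\gamma A-A'$ sends $g$ to $Ag'+\gamma Ag-A'g$. The notation $\int^x$ denotes any fixed primitive. *)

theory Defs
  imports "HOL-Analysis.Analysis"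
begin

text \<open>Smooth functions on an open set \<open>S\<close>: a function is \<open>C\<^sup>n\<^sup>+\<^sup>1\<close> if it is
  (Frechet) differentiable on \<open>S\<close> and all of its directional derivatives are \<open>C\<^sup>n\<close>.\<close>

primrec Ck_on ::
  "nat \<Rightarrow> 'a::real_normed_vector set \<Rightarrow> ('a \<Rightarrow> 'b::real_normed_vector) \<Rightarrow> bool" where
  "Ck_on 0 S f \<longleftrightarrow> continuous_on S f"
| "Ck_on (Suc n) S f \<longleftrightarrow>
     (\<forall>x\<in>S. f differentiable (at x)) \<and>
     (\<forall>u. Ck_on n S (\<lambda>x. frechet_derivative f (at x) u))"

definition smooth_on ::
  "'a::real_normed_vector set \<Rightarrow> ('a \<Rightarrow> 'b::real_normed_vector) \<Rightarrow> bool" where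
  "smooth_on S f \<longleftrightarrow> (\<forall>n. Ck_on n S f)"

definition open_interval :: "real set \<Rightarrow> bool" where
  "open_interval I \<longleftrightarrow> open I \<and> is_interval I \<and> I \<noteq> {}"

definition primitive_on :: "real set \<Rightarrow> (real \<Rightarrow> real) \<Rightarrow> (real \<Rightarrow> real) \<Rightarrow> bool" where
  "primitive_on I f F \<longleftrightarrow> (\<forall>x\<in>I. (F has_real_derivative f x) (at x))"

text \<open>\<open>x\<close>, restricted to the open interval \<open>J\<close>, is a solution with values in \<open>I\<close> of
  the equation \<open>x'' = X(x, x')\<close>; \<open>v\<close> is the velocity \<open>x'\<close>.\<close>

definition is_solution ::
  "(real \<Rightarrow> real \<Rightarrow> real) \<Rightarrow> real set \<Rightarrow> real set \<Rightarrow> (real \<Rightarrow> real) \<Rightarrow> bool" where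
  "is_solution X I J x \<longleftrightarrow>
     open_interval J \<and> x ` J \<subseteq> I \<and>
     (\<exists>v. \<forall>t\<in>J. (x has_real_derivative v t) (at t) \<and>
                (v has_real_derivative X (x t) (v t)) (at t))"

definition smooth_diffeo :: "real set \<Rightarrow> (real \<Rightarrow> real) \<Rightarrow> bool" where
  "smooth_diffeo I \<phi> \<longleftrightarrow>
     smooth_on I \<phi> \<and> inj_on \<phi> I \<and> open_interval (\<phi> ` I) \<and>
     smooth_on (\<phi> ` I) (the_inv_into I \<phi>)"

definition gen_sundman :: "real set \<Rightarrow> (real \<Rightarrow> real) \<Rightarrow> (real \<Rightarrow> real) \<Rightarrow> bool" where
  "gen_sundman I h \<phi> \<longleftrightarrow>
     smooth_on I h \<and> (\<forall>x\<in>I. h x \<noteq> 0) \<and> smooth_diffeo I \<phi>"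

text \<open>The image of a curve \<open>x\<close> on \<open>J\<close> is the curve \<open>y\<close> on \<open>\<tau>(J)\<close> with
  \<open>y(\<tau>(t)) = \<phi>(x(t))\<close>, where \<open>d\<tau>/dt = h(x(t))\<close>. Since \<open>h\<close> has no zeros, \<open>\<tau>\<close> is
  injective on \<open>J\<close>. The transformed equation is \<open>y'' = Y(y, y')\<close> on \<open>\<phi>(I)\<close>.\<close>

definition transforms_into ::
  "real set \<Rightarrow> (real \<Rightarrow> real) \<Rightarrow> (real \<Rightarrow> real) \<Rightarrow>
   (real \<Rightarrow> real \<Rightarrow> real) \<Rightarrow> (real \<Rightarrow> real \<Rightarrow> real) \<Rightarrow> bool" where
  "transforms_into I h \<phi> X Y \<longleftrightarrow>
     (\<forall>J x \<tau>. is_solution X I J x \<longrightarrow>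
        (\<forall>t\<in>J. (\<tau> has_real_derivative h (x t)) (at t)) \<longrightarrow>
        is_solution Y (\<phi> ` I) (\<tau> ` J) (\<lambda>s. \<phi> (x (the_inv_into J \<tau> s))))"

definition fibre_linearisable :: "real set \<Rightarrow> (real \<Rightarrow> real \<Rightarrow> real) \<Rightarrow> bool" where
  "fibre_linearisable I X \<longleftrightarrow>
     (\<exists>h \<phi> \<A> \<B>. gen_sundman I h \<phi> \<and> smooth_on (\<phi> ` I) \<A> \<and> smooth_on (\<phi> ` I) \<B> \<and>
        transforms_into I h \<phi> X (\<lambda>y w. - (\<A> y * w + \<B> y)))"

definition gs_linearisable :: "real set \<Rightarrow> (real \<Rightarrow> real \<Rightarrow> real) \<Rightarrow> bool" where
  "gs_linearisable I X \<longleftrightarrow>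
     (\<exists>h \<phi> \<alpha> B C. gen_sundman I h \<phi> \<and>
        transforms_into I h \<phi> X (\<lambda>y w. - (\<alpha> * w + B * y + C)))"

text \<open>The equation \<open>x'' = X(x, x')\<close> reads \<open>x'' + \<gamma>(x) x'\<^sup>2 + A(x) x' + b(x) = 0\<close>.\<close>

definition has_form ::
  "real set \<Rightarrow> (real \<Rightarrow> real \<Rightarrow> real) \<Rightarrow>
   (real \<Rightarrow> real) \<Rightarrow> (real \<Rightarrow> real) \<Rightarrow> (real \<Rightarrow> real) \<Rightarrow> bool" where
  "has_form I X \<gamma> A b \<longleftrightarrow>
     smooth_on I \<gamma> \<and> smooth_on I A \<and> smooth_on I b \<and>
     (\<forall>x\<in>I. \<forall>v. X x v = - (\<gamma> x * v\<^sup>2 + A x * v + b x))"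

definition zero_on :: "real set \<Rightarrow> (real \<Rightarrow> real) \<Rightarrow> bool" where
  "zero_on I f \<longleftrightarrow> (\<forall>x\<in>I. f x = 0)"

definition nowhere_zero_on :: "real set \<Rightarrow> (real \<Rightarrow> real) \<Rightarrow> bool" where
  "nowhere_zero_on I f \<longleftrightarrow> (\<forall>x\<in>I. f x \<noteq> 0)"

text \<open>The operators \<open>A d/dx - 3A'\<close> and \<open>A d/dx + \<gamma>A - A'\<close>, and \<open>Q\<close> as their composition
  applied to \<open>b\<close>.\<close>

definition outer_op :: "(real \<Rightarrow> real) \<Rightarrow> (real \<Rightarrow> real) \<Rightarrow> real \<Rightarrow> real" where
  "outer_op A g = (\<lambda>x. A x * deriv g x - 3 * deriv A x * g x)"

definition inner_op ::
  "(real \<Rightarrow> real) \<Rightarrow> (real \<Rightarrow> real) \<Rightarrow> (real \<Rightarrow> real) \<Rightarrow> real \<Rightarrow> real" where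
  "inner_op \<gamma> A g = (\<lambda>x. A x * deriv g x + \<gamma> x * A x * g x - deriv A x * g x)"

definition Q_lin ::
  "(real \<Rightarrow> real) \<Rightarrow> (real \<Rightarrow> real) \<Rightarrow> (real \<Rightarrow> real) \<Rightarrow> real \<Rightarrow> real" where
  "Q_lin \<gamma> A b = outer_op A (inner_op \<gamma> A b)"

end

theory Submission
  imports Defs
begin

text \<open>With \<open>k = \<phi>' / h\<close>, the velocity of the image curve is \<open>w(\<tau>(t)) = k(x(t)) x'(t)\<close>.
  Differentiating this along a solution shows that \<open>(h, \<phi>)\<close> transforms \<open>X\<close> into \<open>Y\<close> iff
  \<open>h Y(\<phi>, k v) = k' v\<^sup>2 + k X(x, v)\<close> on all of \<open>I \<times> \<real>\<close>; necessity at a given \<open>(x, v)\<close>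
  needs a solution through that point, i.e. the Picard-Lindelof theorem. For
  \<open>Y = - (\<A>(y) w + \<B>(y))\<close> the identity forces \<open>\<gamma> = k' / k\<close>, \<open>A = h \<A>(\<phi>)\<close> and
  \<open>b = h \<B>(\<phi>) / k\<close>, and conversely \<open>k\<close> is a constant multiple of \<open>exp \<Gamma>\<close>, where \<open>\<Gamma>' = \<gamma>\<close>.
  If \<open>\<A>\<close> is a constant \<open>\<alpha> \<noteq> 0\<close>, then \<open>(\<gamma> A + A d/dx - A') b = \<alpha> h\<^sup>3 \<B>'(\<phi>)\<close>, so that
  \<open>Q = 0\<close> says that \<open>\<B>'\<close> is constant.\<close>

section \<open>Smooth functions of one real variable\<close>

text \<open>The filter \<open>at x\<close> sees a full neighbourhood of \<open>x\<close>, so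
  openness of \<open>S\<close> is what lets agreement on \<open>S\<close> carry over to all
  derivatives.\<close>

lemma Ck_on_cong:
  assumes "open S" "\<And>x. x \<in> S \<Longrightarrow> f x = g x"
  shows "Ck_on n S f \<longleftrightarrow> Ck_on n S g"
  using assms(2)
proof (induction n arbitrary: f g)
  case 0
  then show ?case using continuous_on_cong[of S S f g] by (simp only: Ck_on.simps)
next
  case (Suc n)
  have der: "(f has_derivative D) (at x) \<longleftrightarrow> (g has_derivative D) (at x)" if "x \<in> S" for x D
    using has_derivative_transform_within_open[OF _ assms(1) that] Suc.prems by metis
  then have "Ck_on n S (\<lambda>x. frechet_derivative f (at x) u) \<longleftrightarrow>
      Ck_on n S (\<lambda>x. frechet_derivative g (at x) u)" for u
    by (intro Suc.IH) (simp add: frechet_derivative_def)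
  moreover have "f differentiable (at x) \<longleftrightarrow> g differentiable (at x)" if "x \<in> S" for x
    using der that by (simp add: differentiable_def)
  ultimately show ?case
    unfolding Ck_on.simps by blast
qed

text \<open>Comes before the product rule because the next lemma relies on it: on the line, the
  derivative in direction \<open>u\<close> is the derivative times the constant
  \<open>u\<close>.\<close>

lemma Ck_on_mult_right:
  fixes f :: "real \<Rightarrow> real"
  assumes "open S" "Ck_on n S f"
  shows "Ck_on n S (\<lambda>x. f x * c)"
  using assms(2)
proof (induction n arbitrary: f)
  case 0
  then show ?case by (simp add: continuous_on_mult_right)
next
  case (Suc n)
  have D: "((\<lambda>x. f x * c) has_derivative (\<lambda>u. frechet_derivative f (at x) u * c)) (at x)"
    if "x \<in> S" for x
    using Suc.prems that by (auto intro!: has_derivative_mult_left simp: frechet_derivative_works[symmetric])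
  then have eq: "frechet_derivative (\<lambda>x. f x * c) (at x) = (\<lambda>u. frechet_derivative f (at x) u * c)"
    if "x \<in> S" for x
    using frechet_derivative_at that by metis
  have "Ck_on n S (\<lambda>x. frechet_derivative (\<lambda>x. f x * c) (at x) u)" for u
    using Ck_on_cong[OF assms(1), of "\<lambda>x. frechet_derivative (\<lambda>x. f x * c) (at x) u"
        "\<lambda>x. frechet_derivative f (at x) u * c" n] eq Suc by simp
  then show ?case
    using D by (auto simp: differentiable_def)
qed

text \<open>A linear map of the line is multiplication by its value at 1, so one derivative function
  replaces the family of directional ones. The later inductions on the class go through this
  form.\<close>

lemma Ck_on_Suc_real:
  fixes f :: "real \<Rightarrow> real"
  assumes S: "open S"
  shows "Ck_on (Suc n) S f \<longleftrightarrow>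
    (\<exists>g. (\<forall>x\<in>S. (f has_real_derivative g x) (at x)) \<and> Ck_on n S g)"
proof
  assume L: "Ck_on (Suc n) S f"
  have "(f has_real_derivative frechet_derivative f (at x) 1) (at x)" if "x \<in> S" for x
  proof -
    have "(f has_derivative frechet_derivative f (at x)) (at x)"
      using L that by (simp add: frechet_derivative_works[symmetric])
    moreover from this have "frechet_derivative f (at x) u = frechet_derivative f (at x) 1 * u" for u
      using linear_scale[OF has_derivative_linear, of f "frechet_derivative f (at x)" "at x" u 1]
      by (metis mult.commute mult.right_neutral real_scaleR_def)
    then have "frechet_derivative f (at x) = (*) (frechet_derivative f (at x) 1)"
      by (rule ext)
    ultimately show ?thesis
      unfolding has_field_derivative_def by simp
  qed
  then show "\<exists>g. (\<forall>x\<in>S. (f has_real_derivative g x) (at x)) \<and> Ck_on n S g"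
    using L by (intro exI[of _ "\<lambda>x. frechet_derivative f (at x) 1"]) auto
next
  assume "\<exists>g. (\<forall>x\<in>S. (f has_real_derivative g x) (at x)) \<and> Ck_on n S g"
  then obtain g where g: "\<And>x. x \<in> S \<Longrightarrow> (f has_real_derivative g x) (at x)" "Ck_on n S g"
    by auto
  then have fd: "frechet_derivative f (at x) = (*) (g x)" if "x \<in> S" for x
    using that frechet_derivative_at[of f "(*) (g x)" x] by (simp add: has_field_derivative_def)
  have "Ck_on n S (\<lambda>x. frechet_derivative f (at x) u)" for u
    using Ck_on_cong[OF S, of "\<lambda>x. frechet_derivative f (at x) u" "\<lambda>x. g x * u" n]
      Ck_on_mult_right[OF S g(2)] fd by simp
  moreover have "f differentiable (at x)" if "x \<in> S" for x
    using g(1)[OF that] by (auto simp: has_field_derivative_def differentiable_def)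
  ultimately show "Ck_on (Suc n) S f"
    by simp
qed

lemma Ck_on_continuous:
  fixes f :: "real \<Rightarrow> real"
  assumes "open S" "Ck_on n S f"
  shows "continuous_on S f"
proof (cases n)
  case (Suc m)
  then show ?thesis
    using assms by (auto simp: continuous_on_eq_continuous_at differentiable_imp_continuous_within)
qed (use assms in simp)

text \<open>The recursion does not compare the classes directly: the drop is passed on to the
  derivative until it reaches differentiability implying continuity.\<close>

lemma Ck_on_Suc_imp:
  fixes f :: "real \<Rightarrow> real"
  assumes "open S" "Ck_on (Suc n) S f"
  shows "Ck_on n S f"
  using assms(2)
proof (induction n arbitrary: f)
  case 0
  then show ?case using Ck_on_continuous[OF assms(1) 0] by (simp only: Ck_on.simps)
next
  case (Suc n)
  then obtain g where "\<forall>x\<in>S. (f has_real_derivative g x) (at x)" "Ck_on (Suc n) S g"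
    using Ck_on_Suc_real[OF assms(1), of "Suc n" f] by blast
  then show ?case
    using Suc.IH Ck_on_Suc_real[OF assms(1), of n f] by blast
qed

lemma Ck_on_add:
  fixes f g :: "real \<Rightarrow> real"
  assumes S: "open S" and "Ck_on n S f" "Ck_on n S g"
  shows "Ck_on n S (\<lambda>x. f x + g x)"
  using assms(2,3)
proof (induction n arbitrary: f g)
  case 0
  then show ?case by (simp add: continuous_on_add)
next
  case (Suc n)
  then obtain f' g' where "\<forall>x\<in>S. (f has_real_derivative f' x) (at x)" "Ck_on n S f'"
    "\<forall>x\<in>S. (g has_real_derivative g' x) (at x)" "Ck_on n S g'"
    unfolding Ck_on_Suc_real[OF S] by metis
  then show ?case
    unfolding Ck_on_Suc_real[OF S]
    by (intro exI[of _ "\<lambda>x. f' x + g' x"]) (auto intro!: derivative_eq_intros Suc.IH)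
qed

lemma Ck_on_mult:
  fixes f g :: "real \<Rightarrow> real"
  assumes S: "open S" and "Ck_on n S f" "Ck_on n S g"
  shows "Ck_on n S (\<lambda>x. f x * g x)"
  using assms(2,3)
proof (induction n arbitrary: f g)
  case 0
  then show ?case by (simp add: continuous_on_mult)
next
  case (Suc n)
  then obtain f' g' where "\<forall>x\<in>S. (f has_real_derivative f' x) (at x)" "Ck_on n S f'"
    "\<forall>x\<in>S. (g has_real_derivative g' x) (at x)" "Ck_on n S g'"
    unfolding Ck_on_Suc_real[OF S] by metis
  \<comment> \<open>The product rule multiplies derivatives by the functions themselves, which are
    therefore lowered to the class of the derivatives.\<close>
  moreover have "Ck_on n S f" "Ck_on n S g"
    using Suc.prems Ck_on_Suc_imp[OF S] by blast+
  ultimately show ?case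
    unfolding Ck_on_Suc_real[OF S]
    by (intro exI[of _ "\<lambda>x. f' x * g x + g' x * f x"])
      (auto intro!: DERIV_mult Ck_on_add[OF S] Suc.IH)
qed

lemma Ck_on_compose:
  fixes f g :: "real \<Rightarrow> real"
  assumes S: "open S" and T: "open T" and "Ck_on n T f" "Ck_on n S g" and img: "g ` S \<subseteq> T"
  shows "Ck_on n S (\<lambda>x. f (g x))"
  using assms(3,4)
proof (induction n arbitrary: f)
  case 0
  then show ?case using img by (simp add: continuous_on_compose2)
next
  case (Suc n)
  then obtain f' g' where "\<forall>x\<in>T. (f has_real_derivative f' x) (at x)" "Ck_on n T f'"
    "\<forall>x\<in>S. (g has_real_derivative g' x) (at x)" "Ck_on n S g'"
    unfolding Ck_on_Suc_real[OF S] Ck_on_Suc_real[OF T] by metis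
  moreover have "Ck_on n S g"
    using Suc.prems Ck_on_Suc_imp[OF S] by blast
  ultimately show ?case
    unfolding Ck_on_Suc_real[OF S] using img
    by (intro exI[of _ "\<lambda>x. f' (g x) * g' x"])
      (force intro: DERIV_chain2[of f] Ck_on_mult[OF S] Suc.IH)
qed

section \<open>Closure properties of smooth functions on the line\<close>

lemma smooth_on_cong:
  assumes "open S" "\<And>x. x \<in> S \<Longrightarrow> f x = g x"
  shows "smooth_on S f \<longleftrightarrow> smooth_on S g"
  using Ck_on_cong[OF assms] by (simp add: smooth_on_def)

lemma smooth_on_deriv:
  fixes f :: "real \<Rightarrow> real"
  assumes S: "open S" and f: "smooth_on S f"
  shows "\<And>x. x \<in> S \<Longrightarrow> (f has_real_derivative deriv f x) (at x)" and "smooth_on S (deriv f)"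
proof -
  have "\<exists>g. (\<forall>x\<in>S. (f has_real_derivative g x) (at x)) \<and> Ck_on n S g" for n
    using f Ck_on_Suc_real[OF S, of n f] unfolding smooth_on_def by blast
  \<comment> \<open>Each order \<open>n\<close> supplies its own derivative \<open>g n\<close>;
    uniqueness identifies them all with \<open>deriv f\<close> on \<open>S\<close>, which is thus of
    every class.\<close>
  then obtain g where g: "\<And>n x. x \<in> S \<Longrightarrow> (f has_real_derivative g n x) (at x)" "\<And>n. Ck_on n S (g n)"
    by metis
  then have eq: "deriv f x = g n x" if "x \<in> S" for n x
    using that DERIV_imp_deriv by blast
  show "(f has_real_derivative deriv f x) (at x)" if "x \<in> S" for x
    using g(1) eq that by metis
  show "smooth_on S (deriv f)"
    using Ck_on_cong[OF S eq] g(2) by (simp add: smooth_on_def)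
qed

lemma smooth_on_derivI:
  fixes f :: "real \<Rightarrow> real"
  assumes S: "open S" and "\<And>x. x \<in> S \<Longrightarrow> (f has_real_derivative g x) (at x)" "smooth_on S g"
  shows "smooth_on S f"
  unfolding smooth_on_def
proof
  fix n
  \<comment> \<open>One class up and back down, so that \<open>n = 0\<close> needs no separate
    argument.\<close>
  have "Ck_on (Suc n) S f"
    unfolding Ck_on_Suc_real[OF S] using assms by (auto simp: smooth_on_def)
  then show "Ck_on n S f"
    by (rule Ck_on_Suc_imp[OF S])
qed

lemma smooth_on_continuous:
  fixes f :: "real \<Rightarrow> real"
  assumes "open S" "smooth_on S f"
  shows "continuous_on S f"
  using assms Ck_on_continuous by (auto simp: smooth_on_def)

lemma Ck_on_const:
  fixes c :: real
  assumes "open S"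
  shows "Ck_on n (S :: real set) (\<lambda>x. c)"
proof (induction n arbitrary: c)
  case (Suc n)
  then show ?case
    unfolding Ck_on_Suc_real[OF assms] by (intro exI[of _ "\<lambda>x. 0"]) auto
qed simp

lemma smooth_on_const:
  fixes c :: real
  assumes "open S"
  shows "smooth_on (S :: real set) (\<lambda>x. c)"
  using Ck_on_const[OF assms] by (simp add: smooth_on_def)

lemma smooth_on_ident:
  assumes "open S"
  shows "smooth_on (S :: real set) (\<lambda>x. x)"
  by (rule smooth_on_derivI[OF assms _ smooth_on_const[OF assms, of 1]]) auto

lemma smooth_on_add:
  fixes f g :: "real \<Rightarrow> real"
  assumes "open S" "smooth_on S f" "smooth_on S g"
  shows "smooth_on S (\<lambda>x. f x + g x)"
  using assms Ck_on_add by (simp add: smooth_on_def)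

lemma smooth_on_mult:
  fixes f g :: "real \<Rightarrow> real"
  assumes "open S" "smooth_on S f" "smooth_on S g"
  shows "smooth_on S (\<lambda>x. f x * g x)"
  using assms Ck_on_mult by (simp add: smooth_on_def)

lemma smooth_on_compose:
  fixes f g :: "real \<Rightarrow> real"
  assumes "open S" "open T" "smooth_on T f" "smooth_on S g" "g ` S \<subseteq> T"
  shows "smooth_on S (\<lambda>x. f (g x))"
  using assms Ck_on_compose by (simp add: smooth_on_def)

lemma smooth_on_exp:
  fixes f :: "real \<Rightarrow> real"
  assumes "open S" "smooth_on S f"
  shows "smooth_on S (\<lambda>x. exp (f x))"
proof -
  have "Ck_on n UNIV (exp :: real \<Rightarrow> real)" for n
  proof (induction n)
    case (Suc n)
    then show ?case
      unfolding Ck_on_Suc_real[OF open_UNIV] by (intro exI[of _ exp]) (auto intro: DERIV_exp)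
  qed (simp add: continuous_on_exp)
  then have "smooth_on UNIV (exp :: real \<Rightarrow> real)"
    by (simp add: smooth_on_def)
  then show ?thesis
    using smooth_on_compose[OF assms(1) open_UNIV _ assms(2)] by simp
qed

lemma smooth_on_inverse:
  fixes f :: "real \<Rightarrow> real"
  assumes S: "open S" and f: "smooth_on S f" and nz: "\<And>x. x \<in> S \<Longrightarrow> f x \<noteq> 0"
  shows "smooth_on S (\<lambda>x. inverse (f x))"
proof -
  have "Ck_on n (- {0}) (inverse :: real \<Rightarrow> real)" for n
  proof (induction n)
    case (Suc n)
    have op: "open (- {0::real})" by (simp add: open_Compl)
    \<comment> \<open>\<open>inverse\<close> differentiates to a product of copies of itself, so the
      induction hypothesis covers the derivative.\<close>
    have "Ck_on n (- {0}) (\<lambda>x::real. - 1 * (inverse x * inverse x))"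
      by (intro Ck_on_mult op Ck_on_const Suc)
    then show ?case
      unfolding Ck_on_Suc_real[OF op]
      by (intro exI[of _ "\<lambda>x. - 1 * (inverse x * inverse x)"])
        (auto intro!: derivative_eq_intros simp: power2_eq_square)
  qed (auto intro!: continuous_intros)
  then have "smooth_on (- {0}) (inverse :: real \<Rightarrow> real)"
    by (simp add: smooth_on_def)
  then show ?thesis
    using smooth_on_compose[OF S _ _ f, of "- {0}" inverse] nz by (force simp: open_Compl)
qed

lemma smooth_on_divide:
  fixes f g :: "real \<Rightarrow> real"
  assumes "open S" "smooth_on S f" "smooth_on S g" "\<And>x. x \<in> S \<Longrightarrow> g x \<noteq> 0"
  shows "smooth_on S (\<lambda>x. f x / g x)"
  using smooth_on_mult[OF assms(1,2) smooth_on_inverse[OF assms(1,3,4)]]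
  by (simp add: divide_inverse)

lemma smooth_on_minus:
  fixes f :: "real \<Rightarrow> real"
  assumes "open S" "smooth_on S f"
  shows "smooth_on S (\<lambda>x. - f x)"
  using smooth_on_mult[OF assms smooth_on_const[OF assms(1), of "-1"]] by simp

section \<open>Open intervals and diffeomorphisms\<close>

lemma open_interval_between:
  assumes "open_interval I" "a \<in> I" "b \<in> I" "a \<le> x" "x \<le> b"
  shows "x \<in> I"
  using assms mem_is_interval_1_I[of I a b x] by (simp add: open_interval_def)

lemma open_interval_neighbours:
  assumes "open_interval I" "x \<in> I"
  obtains a b where "a \<in> I" "b \<in> I" "a < x" "x < b"
proof -
  obtain e where e: "e > 0" "ball x e \<subseteq> I"
    using assms openE[of I x] by (auto simp: open_interval_def)
  then have "x - e / 2 \<in> I" "x + e / 2 \<in> I"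
    by (auto simp: dist_real_def subset_iff)
  with e show thesis
    by (intro that[of "x - e / 2" "x + e / 2"]) auto
qed

lemma primitive_on_exists:
  assumes I: "open_interval I" and f: "continuous_on I f"
  shows "\<exists>F. primitive_on I f F"
proof -
  \<comment> \<open>\<open>I\<close> may be unbounded, so its endpoints are taken as extended reals;
    openness keeps them out of \<open>I\<close>.\<close>
  let ?a = "Inf (ereal ` I)" and ?b = "Sup (ereal ` I)"
  have in_I: "x \<in> I" if "?a < ereal x" "ereal x < ?b" for x
    using that open_interval_between[OF I] by (auto simp: Inf_less_iff less_Sup_iff intro: less_imp_le)
  have bounds: "?a < ereal x" "ereal x < ?b" if "x \<in> I" for x
    using open_interval_neighbours[OF I that] by (force simp: Inf_less_iff less_Sup_iff)+
  obtain c where "c \<in> I"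
    using I by (auto simp: open_interval_def)
  then have "?a < ?b"
    using bounds less_trans by blast
  moreover have "isCont f x" if "?a < ereal x" "ereal x < ?b" for x
    using f in_I[OF that] I by (simp add: continuous_on_eq_continuous_at open_interval_def)
  ultimately obtain F where "\<forall>x. ?a < ereal x \<longrightarrow> ereal x < ?b \<longrightarrow> (F has_vector_derivative f x) (at x)"
    using einterval_antiderivative[of ?a ?b f] by blast
  then show ?thesis
    using bounds by (auto simp: primitive_on_def has_real_derivative_iff_has_vector_derivative)
qed

text \<open>Intermediate values exclude a change of sign. The sign is returned as a number since it
  becomes the coefficient \<alpha> and a factor of \<open>k\<close>.\<close>

lemma constant_sgn:
  fixes f :: "real \<Rightarrow> real"
  assumes I: "open_interval I" and f: "continuous_on I f" and nz: "\<And>x. x \<in> I \<Longrightarrow> f x \<noteq> 0"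
  obtains s where "s = 1 \<or> s = -1" "\<And>x. x \<in> I \<Longrightarrow> sgn (f x) = s"
proof -
  have "connected (f ` I)"
    using I f by (intro connected_continuous_image) (auto simp: open_interval_def is_interval_connected_1)
  then have "0 \<in> f ` I" if "x \<in> I" "y \<in> I" "f x < 0" "0 < f y" for x y
    using connectedD_interval[of "f ` I" "f x" "f y" 0] that by simp
  then have no_change: "\<not> (f x < 0 \<and> 0 < f y)" if "x \<in> I" "y \<in> I" for x y
    using that nz by (metis imageE)
  obtain c where c: "c \<in> I"
    using I by (auto simp: open_interval_def)
  consider "f c > 0" | "f c < 0"
    using nz[OF c] by linarith
  then show thesis
  proof cases
    case 1
    then have "sgn (f x) = 1" if "x \<in> I" for x
      using no_change[OF that c] nz[OF that] by (simp add: sgn_real_def)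
    then show thesis by (intro that[of 1]) auto
  next
    case 2
    then have "sgn (f x) = -1" if "x \<in> I" for x
      using no_change[OF c that] nz[OF that] by (simp add: sgn_real_def)
    then show thesis by (intro that[of "-1"]) auto
  qed
qed

section \<open>Nonvanishing derivatives and inverse functions, for both \<phi> and the new time
  \<tau>\<close>

lemma inj_on_nonzero_deriv:
  fixes f :: "real \<Rightarrow> real"
  assumes I: "open_interval I" and f: "\<And>x. x \<in> I \<Longrightarrow> (f has_real_derivative g x) (at x)"
    and nz: "\<And>x. x \<in> I \<Longrightarrow> g x \<noteq> 0"
  shows "inj_on f I"
proof (rule linorder_inj_onI)
  fix x y assume xy: "x < y" "x \<in> I" "y \<in> I"
  have "(f has_real_derivative g z) (at z)" if "x \<le> z" "z \<le> y" for z
    using f open_interval_between[OF I xy(2,3) that] .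
  then have "\<exists>z>x. z < y \<and> f y - f x = (y - x) * g z"
    by (rule MVT2[OF xy(1)])
  then obtain z where z: "x < z" "z < y" "f y - f x = (y - x) * g z"
    by blast
  then have "g z \<noteq> 0"
    using nz open_interval_between[OF I xy(2,3)] by simp
  then show "f x \<noteq> f y"
    using z xy(1) by auto
next
  show "x \<le> y \<or> y \<le> x" for x y :: real by linarith
qed

lemma open_interval_image:
  fixes f :: "real \<Rightarrow> real"
  assumes I: "open_interval I" and "continuous_on I f" "inj_on f I"
  shows "open_interval (f ` I)"
  unfolding open_interval_def
proof (intro conjI)
  show "open (f ` I)"
    using assms injective_eq_1d_open_map_UNIV[of I f] by (auto simp: open_interval_def)
  show "is_interval (f ` I)"
    using assms by (simp add: open_interval_def is_interval_connected_1 connected_continuous_image)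
qed (use I in \<open>auto simp: open_interval_def\<close>)

lemma the_inv_into_has_real_derivative:
  fixes f :: "real \<Rightarrow> real"
  assumes I: "open_interval I" and f: "\<And>x. x \<in> I \<Longrightarrow> (f has_real_derivative g x) (at x)"
    and nz: "\<And>x. x \<in> I \<Longrightarrow> g x \<noteq> 0" and x: "x \<in> I"
  shows "(the_inv_into I f has_real_derivative inverse (g x)) (at (f x))"
proof -
  have inj: "inj_on f I"
    using inj_on_nonzero_deriv[OF I f nz] by blast
  have "continuous_on I f"
    by (intro continuous_at_imp_continuous_on ballI DERIV_isCont[OF f])
  then show ?thesis
    unfolding has_field_derivative_def
    using I x f[OF x] nz[OF x] the_inv_into_f_f[OF inj]
    by (intro has_derivative_inverse_strong[of I x f _ "(*) (g x)"])
      (auto simp: open_interval_def has_field_derivative_def)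
qed

text \<open>Bootstrapping: the inverse \<open>i\<close> satisfies \<open>i' = 1 / g(i)\<close>, so
  if \<open>i\<close> is of class \<open>n\<close> then so is its derivative, and \<open>i\<close>
  is of class \<open>n + 1\<close>.\<close>

lemma smooth_diffeo_deriv:
  assumes I: "open_interval I" and f: "\<And>x. x \<in> I \<Longrightarrow> (f has_real_derivative g x) (at x)"
    and g: "smooth_on I g" and nz: "\<And>x. x \<in> I \<Longrightarrow> g x \<noteq> 0"
  shows "smooth_diffeo I f"
proof -
  have op: "open I"
    using I by (simp add: open_interval_def)
  have inj: "inj_on f I"
    using inj_on_nonzero_deriv[OF I f nz] by blast
  have cont: "continuous_on I f"
    by (intro continuous_at_imp_continuous_on ballI DERIV_isCont[OF f])
  have J: "open_interval (f ` I)"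
    by (rule open_interval_image[OF I cont inj])
  then have opJ: "open (f ` I)"
    by (simp add: open_interval_def)
  let ?i = "the_inv_into I f"
  have i_in: "?i ` (f ` I) \<subseteq> I"
    using the_inv_into_f_f[OF inj] by auto
  have D: "(?i has_real_derivative inverse (g (?i y))) (at y)" if "y \<in> f ` I" for y
  proof -
    obtain x where x: "x \<in> I" "y = f x"
      using \<open>y \<in> f ` I\<close> by blast
    then show ?thesis
      using the_inv_into_has_real_derivative[OF I f nz x(1)] the_inv_into_f_f[OF inj x(1)] by simp
  qed
  have "Ck_on n (f ` I) ?i" for n
  proof (induction n)
    case 0
    show ?case
      unfolding Ck_on.simps by (intro continuous_at_imp_continuous_on ballI DERIV_isCont[OF D])
  next
    case (Suc n)
    have "Ck_on n I (\<lambda>x. inverse (g x))"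
      using smooth_on_inverse[OF op g nz] by (simp add: smooth_on_def)
    then have "Ck_on n (f ` I) (\<lambda>y. inverse (g (?i y)))"
      using Ck_on_compose[OF opJ op _ Suc i_in] by blast
    with D show ?case
      unfolding Ck_on_Suc_real[OF opJ] by (intro exI[of _ "\<lambda>y. inverse (g (?i y))"] conjI ballI)
  qed
  then show ?thesis
    using smooth_on_derivI[OF op f g] inj J by (simp add: smooth_diffeo_def smooth_on_def)
qed

text \<open>Smoothness of the inverse is essential, as the cube on the line shows: at a zero of
  \<open>\<phi>'\<close>, differentiating the inverse composed with \<phi> would give both 0 and
  1.\<close>

lemma smooth_diffeo_deriv_nonzero:
  assumes I: "open_interval I" and \<phi>: "smooth_diffeo I \<phi>" and x: "x \<in> I"
  shows "deriv \<phi> x \<noteq> 0"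
proof
  assume z: "deriv \<phi> x = 0"
  have op: "open I" "open (\<phi> ` I)" and inj: "inj_on \<phi> I"
    using I \<phi> by (auto simp: open_interval_def smooth_diffeo_def)
  have 1: "(\<phi> has_real_derivative 0) (at x)"
    using smooth_on_deriv(1)[OF op(1) _ x, of \<phi>] \<phi> z by (simp add: smooth_diffeo_def)
  have 2: "(the_inv_into I \<phi> has_real_derivative deriv (the_inv_into I \<phi>) (\<phi> x)) (at (\<phi> x))"
    using smooth_on_deriv(1)[OF op(2), of "the_inv_into I \<phi>"] \<phi> x by (simp add: smooth_diffeo_def)
  have "((\<lambda>x. the_inv_into I \<phi> (\<phi> x)) has_real_derivative 0) (at x)"
    using DERIV_chain2[OF 2 1] by simp
  moreover have "((\<lambda>x. the_inv_into I \<phi> (\<phi> x)) has_real_derivative 1) (at x)"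
    by (rule has_field_derivative_transform_within_open[OF DERIV_ident op(1) x])
      (simp add: the_inv_into_f_f[OF inj])
  ultimately show False
    using DERIV_unique by fastforce
qed

section \<open>Local solutions\<close>

lemma picard_lindelof_lipschitz:
  fixes F :: "'a::euclidean_space \<Rightarrow> 'a"
  assumes L: "L > 0" and F: "\<And>x y. norm (F x - F y) \<le> L * norm (x - y)"
  obtains d u where "d > 0" "u 0 = p"
    "\<And>t. \<bar>t\<bar> < d \<Longrightarrow> (u has_vector_derivative F (u t)) (at t)"
proof -
  \<comment> \<open>Two integrals, each over a length of at most \<open>2 * d\<close>, enter the
    distance estimate for the Picard map; \<open>4 * d * L = 1 / 2\<close> makes it a
    contraction.\<close>
  define d where "d = 1 / (8 * L)"
  have d: "d > 0" "8 * d * L = 1"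
    using L by (auto simp: d_def)
  \<comment> \<open>Clamping time to \<open>[- d, d]\<close> extends the integrated curves
    constantly, so the Picard map acts on the complete space of bounded continuous functions on the
    whole line.\<close>
  define c where "c t = max (- d) (min d t)" for t
  have c: "c t \<in> {- d..d}" for t
    using d by (auto simp: c_def)
  have c_cont: "continuous_on UNIV c"
    unfolding c_def by (intro continuous_intros)
  have F_cont: "continuous_on UNIV F"
    using F L by (intro lipschitz_on_continuous_on[of L]) (auto simp: lipschitz_on_def dist_norm)
  have Fu_cont: "continuous_on T (\<lambda>s. F (apply_bcontfun u s))" for T u
    by (intro continuous_on_compose2[OF F_cont]) auto
  \<comment> \<open>Integrals start at \<open>- d\<close>, keeping the lower limit below
    \<open>t\<close> also for negative times; subtracting \<open>G u 0\<close> in \<open>T\<close>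
    restores the initial time 0.\<close>
  define G where "G u t = integral {- d..t} (\<lambda>s. F (apply_bcontfun u s))" for u :: "real \<Rightarrow>\<^sub>C 'a" and t
  have G_cont: "continuous_on {- d..d} (G u)" for u
    unfolding G_def by (intro indefinite_integral_continuous_1 integrable_continuous_real Fu_cont)
  define T where "T u t = p + (G u (c t) - G u 0)" for u t
  have T_mem: "T u \<in> bcontfun" for u
  proof -
    have "bounded (G u ` {- d..d})"
      using G_cont compact_continuous_image compact_imp_bounded by blast
    then have "bounded ((\<lambda>y. (p - G u 0) + y) ` (G u ` {- d..d}))"
      by (rule bounded_translation)
    then have "bounded (range (T u))"
      by (rule bounded_subset) (use c in \<open>auto simp: T_def image_image\<close>)
    moreover have "continuous_on UNIV (T u)"
      unfolding T_def using c
      by (intro continuous_intros continuous_on_compose2[OF G_cont c_cont]) auto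
    ultimately show ?thesis
      by (simp add: bcontfun_def)
  qed
  define \<Phi> where "\<Phi> u = Bcontfun (T u)" for u
  have \<Phi>: "apply_bcontfun (\<Phi> u) t = T u t" for u t
    by (simp add: \<Phi>_def Bcontfun_inverse[OF T_mem])
  have G_diff: "norm (G u t - G w t) \<le> L * dist u w * (2 * d)" if t: "t \<in> {- d..d}" for u w t
  proof -
    have "G u t - G w t = integral {- d..t} (\<lambda>s. F (apply_bcontfun u s) - F (apply_bcontfun w s))"
      unfolding G_def by (intro integral_diff[symmetric] integrable_continuous_real Fu_cont)
    also have "norm \<dots> \<le> L * dist u w * (t - - d)"
    proof (rule integral_bound)
      show "continuous_on {- d..t} (\<lambda>s. F (apply_bcontfun u s) - F (apply_bcontfun w s))"
        by (intro continuous_on_diff Fu_cont)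
      show "norm (F (apply_bcontfun u s) - F (apply_bcontfun w s)) \<le> L * dist u w" for s
        using F[of "apply_bcontfun u s" "apply_bcontfun w s"] dist_bounded[of u s w] L
        by (smt (verit) dist_norm mult_left_mono)
    qed (use t in auto)
    also have "\<dots> \<le> L * dist u w * (2 * d)"
      using t L by (intro mult_left_mono) auto
    finally show ?thesis .
  qed
  have "dist (\<Phi> u) (\<Phi> w) \<le> 1 / 2 * dist u w" for u w
  proof (rule dist_bound)
    fix t
    have "dist (\<Phi> u t) (\<Phi> w t) = norm ((G u (c t) - G w (c t)) - (G u 0 - G w 0))"
      by (simp add: \<Phi> T_def dist_norm algebra_simps)
    also have "\<dots> \<le> L * dist u w * (2 * d) + L * dist u w * (2 * d)"
      using G_diff[OF c, of u t w] G_diff[of 0 u w] d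
      by (intro order_trans[OF norm_triangle_ineq4 add_mono]) auto
    also have "\<dots> = (8 * d * L) / 2 * dist u w"
      by simp
    finally show "dist (\<Phi> u t) (\<Phi> w t) \<le> 1 / 2 * dist u w"
      by (simp only: d)
  qed
  then obtain u where u: "\<Phi> u = u"
    using banach_fix_type[of "1 / 2" \<Phi>] by auto
  have u_eq: "apply_bcontfun u t = T u t" for t
    using \<Phi>[of u t] u by simp
  show thesis
  proof (rule that[OF d(1)])
    show "apply_bcontfun u 0 = p"
      using d by (simp add: u_eq T_def c_def)
    fix t :: real assume t: "\<bar>t\<bar> < d"
    then have t': "t \<in> {- d<..<d}" by auto
    have c_id: "c s = s" if "s \<in> {- d<..<d}" for s
      using that by (simp add: c_def)
    have "(G u has_vector_derivative F (apply_bcontfun u t)) (at t within {- d..d})"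
      unfolding G_def using t by (intro integral_has_vector_derivative Fu_cont) auto
    moreover have "at t within {- d..d} = at t"
      by (rule at_within_interior) (use t' in simp)
    ultimately have "(G u has_vector_derivative F (apply_bcontfun u t)) (at t)"
      by simp
    then have "((\<lambda>t. p + (G u t - G u 0)) has_vector_derivative F (apply_bcontfun u t)) (at t)"
      by (auto intro!: derivative_eq_intros)
    then show "(apply_bcontfun u has_vector_derivative F (apply_bcontfun u t)) (at t)"
      by (rule has_vector_derivative_transform_within_open[OF _ _ t'])
        (simp_all add: u_eq T_def c_id)
  qed
qed

text \<open>Composing \<open>F\<close> with the projection onto the ball, which is 1-Lipschitz,
  makes it globally Lipschitz. The solution starts at the centre, so by continuity it stays for a
  short time in the ball, where the projection is the identity.\<close>

lemma picard_lindelof_cball: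
  fixes F :: "'a::euclidean_space \<Rightarrow> 'a"
  assumes r: "r > 0" and L: "L > 0"
    and F: "\<And>x y. x \<in> cball p r \<Longrightarrow> y \<in> cball p r \<Longrightarrow> norm (F x - F y) \<le> L * norm (x - y)"
  obtains d u where "d > 0" "u 0 = p"
    "\<And>t. \<bar>t\<bar> < d \<Longrightarrow> u t \<in> cball p r \<and> (u has_vector_derivative F (u t)) (at t)"
proof -
  let ?P = "closest_point (cball p r)"
  have P: "?P x \<in> cball p r" for x
    using r by (intro closest_point_in_set) auto
  have "norm (?P x - ?P y) \<le> norm (x - y)" for x y
    using closest_point_lipschitz[of "cball p r" x y] r by (simp add: dist_norm)
  then have "norm (F (?P x) - F (?P y)) \<le> L * norm (x - y)" for x y
    using F[OF P P, of x y] L by (meson mult_left_mono order_trans less_imp_le)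
  then obtain d u where d: "d > 0" "u 0 = p"
    and u: "\<And>t. \<bar>t\<bar> < d \<Longrightarrow> (u has_vector_derivative F (?P (u t))) (at t)"
    using picard_lindelof_lipschitz[OF L, of "\<lambda>x. F (?P x)" p] by blast
  have "isCont u 0"
    using u[of 0] d has_vector_derivative_continuous by auto
  then obtain e where e: "e > 0" "\<And>t. \<bar>t\<bar> < e \<Longrightarrow> dist (u t) (u 0) < r"
    using r unfolding continuous_at_eps_delta by (auto simp: dist_real_def)
  show thesis
  proof (rule that[of "min d e" u])
    fix t :: real assume "\<bar>t\<bar> < min d e"
    then have t: "\<bar>t\<bar> < d" "u t \<in> cball p r"
      using e(2)[of t] d by (auto simp: dist_commute less_imp_le)
    then show "u t \<in> cball p r \<and> (u has_vector_derivative F (u t)) (at t)"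
      using u[OF t(1)] by (simp add: closest_point_self)
  qed (use d e in auto)
qed

text \<open>Smoothness makes each directional derivative continuous, hence bounded on a compact
  ball. The two coordinate directions bound the operator norm, and convexity of the ball turns this
  into a Lipschitz estimate.\<close>

lemma smooth_on_locally_lipschitz:
  fixes f :: "real \<times> real \<Rightarrow> real"
  assumes S: "open S" and f: "smooth_on S f" and p: "p \<in> S"
  obtains r L where "r > 0" "L \<ge> 0" "cball p r \<subseteq> S"
    "\<And>z w. z \<in> cball p r \<Longrightarrow> w \<in> cball p r \<Longrightarrow> \<bar>f z - f w\<bar> \<le> L * norm (z - w)"
proof -
  obtain r where r: "r > 0" "cball p r \<subseteq> S"
    using S p open_contains_cball by blast
  let ?D = "\<lambda>z. frechet_derivative f (at z)"
  have C1: "Ck_on (Suc 0) S f"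
    using f unfolding smooth_on_def by blast
  then have D: "(f has_derivative ?D z) (at z)" if "z \<in> S" for z
    using that frechet_derivative_works by auto
  have "continuous_on S (\<lambda>z. ?D z e)" for e
    using C1 unfolding Ck_on.simps by blast
  then have "bounded ((\<lambda>z. ?D z e) ` cball p r)" for e
    using continuous_on_subset[OF _ r(2)]
    by (intro compact_imp_bounded compact_continuous_image compact_cball) blast
  then have "\<exists>B. \<forall>z\<in>cball p r. \<bar>?D z e\<bar> \<le> B" for e
    by (auto simp: bounded_iff)
  then obtain B where B: "\<And>e z. z \<in> cball p r \<Longrightarrow> \<bar>?D z e\<bar> \<le> B e"
    by metis
  let ?L = "B (1, 0) + B (0, 1)"
  have B0: "B e \<ge> 0" for e
    using B[of p e] r by simp
  have on: "onorm (?D z) \<le> ?L" if z: "z \<in> cball p r" for z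
  proof (rule onorm_bound)
    fix u :: "real \<times> real"
    obtain a b where u: "u = (a, b)" by (cases u)
    have lin: "linear (?D z)"
      using D r z has_derivative_linear by blast
    have "u = a *\<^sub>R (1, 0) + b *\<^sub>R (0, 1)"
      by (simp add: u)
    then have "?D z u = a * ?D z (1, 0) + b * ?D z (0, 1)"
      using linear_add[OF lin] linear_scale[OF lin] by (metis real_scaleR_def)
    then have "\<bar>?D z u\<bar> \<le> \<bar>a\<bar> * \<bar>?D z (1, 0)\<bar> + \<bar>b\<bar> * \<bar>?D z (0, 1)\<bar>"
      by (metis abs_mult abs_triangle_ineq)
    also have "\<dots> \<le> norm u * B (1, 0) + norm u * B (0, 1)"
      using B[OF z] B0 norm_fst_le[of a b] norm_snd_le[of b a]
      by (intro add_mono mult_mono) (auto simp: u)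
    finally show "norm (?D z u) \<le> ?L * norm u"
      by (simp add: algebra_simps)
  qed (use B0 in auto)
  have "(f has_derivative ?D z) (at z within cball p r)" if "z \<in> cball p r" for z
    using D r that by (blast intro: has_derivative_at_withinI)
  then have "norm (f z - f w) \<le> ?L * norm (z - w)" if "z \<in> cball p r" "w \<in> cball p r" for z w
    using that on by (intro differentiable_bound[of "cball p r" f ?D] convex_cball)
  then show thesis
    using that[of r ?L] r B0 by simp
qed

lemma local_solution:
  assumes I: "open_interval I" and X: "smooth_on (I \<times> UNIV) (\<lambda>(x, v). X x v)" and x0: "x0 \<in> I"
  obtains J x v where "open_interval J" "0 \<in> J" "x 0 = x0" "v 0 = v0"
    "\<forall>t\<in>J. x t \<in> I \<and> (x has_real_derivative v t) (at t) \<and>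
      (v has_real_derivative X (x t) (v t)) (at t)"
proof -
  let ?f = "\<lambda>(x, v). X x v" and ?F = "\<lambda>z. (snd z, X (fst z) (snd z))" and ?p = "(x0, v0)"
  have "open (I \<times> (UNIV :: real set))"
    using I by (simp add: open_interval_def open_Times)
  then obtain r L where r: "r > 0" "L \<ge> 0" "cball ?p r \<subseteq> I \<times> UNIV"
    and L: "\<And>z w. z \<in> cball ?p r \<Longrightarrow> w \<in> cball ?p r \<Longrightarrow> \<bar>?f z - ?f w\<bar> \<le> L * norm (z - w)"
    using smooth_on_locally_lipschitz[OF _ X, of ?p] x0 by blast
  \<comment> \<open>The system \<open>(x, v)' = (v, X(x, v))\<close> has Lipschitz constant
    \<open>1 + L\<close>: 1 from the first component and \<open>L\<close> from the second. It is
    positive even if \<open>L = 0\<close>.\<close>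
  have L1: "0 < 1 + L"
    using r(2) by simp
  have lip: "norm (?F z - ?F w) \<le> (1 + L) * norm (z - w)" if "z \<in> cball ?p r" "w \<in> cball ?p r" for z w
  proof -
    have "norm (?F z - ?F w) \<le> norm (snd (z - w)) + \<bar>?f z - ?f w\<bar>"
      using norm_Pair_le[of "snd z - snd w" "?f z - ?f w"] by (simp add: case_prod_beta)
    also have "\<dots> \<le> norm (z - w) + L * norm (z - w)"
      using L[OF that] norm_snd_le[of "snd (z - w)" "fst (z - w)"]
      unfolding prod.collapse by (rule add_mono[rotated])
    finally show ?thesis
      by (simp add: algebra_simps)
  qed
  obtain d u where d: "d > 0" "u 0 = ?p"
    and u: "\<And>t. \<bar>t\<bar> < d \<Longrightarrow> u t \<in> cball ?p r \<and> (u has_vector_derivative ?F (u t)) (at t)"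
    using picard_lindelof_cball[OF r(1) L1 lip] by blast
  show thesis
  proof (rule that[of "{- d<..<d}" "\<lambda>t. fst (u t)" "\<lambda>t. snd (u t)"], goal_cases)
    case 1
    show ?case
      using d by (auto simp: open_interval_def)
  next
    case 5
    show ?case
    proof
      fix t assume "t \<in> {- d<..<d}"
      then have t: "u t \<in> cball ?p r" "(u has_vector_derivative ?F (u t)) (at t)"
        using u[of t] by auto
      then have "fst (u t) \<in> I"
        using r(3) mem_Times_iff subsetD by metis
      moreover have "((\<lambda>t. fst (u t)) has_vector_derivative fst (?F (u t))) (at t)"
        "((\<lambda>t. snd (u t)) has_vector_derivative snd (?F (u t))) (at t)"
        by (rule bounded_linear.has_vector_derivative[OF bounded_linear_fst t(2)]
            bounded_linear.has_vector_derivative[OF bounded_linear_snd t(2)])+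
      ultimately show "fst (u t) \<in> I \<and>
          ((\<lambda>t. fst (u t)) has_real_derivative snd (u t)) (at t) \<and>
          ((\<lambda>t. snd (u t)) has_real_derivative X (fst (u t)) (snd (u t))) (at t)"
        by (simp add: has_real_derivative_iff_has_vector_derivative)
    qed
  qed (use d in auto)
qed

section \<open>Generalised Sundman transformations\<close>

lemma transforms_intoI:
  assumes h: "\<And>x. x \<in> I \<Longrightarrow> h x \<noteq> 0"
    and \<phi>: "\<And>x. x \<in> I \<Longrightarrow> (\<phi> has_real_derivative h x * k x) (at x)"
    and k: "\<And>x. x \<in> I \<Longrightarrow> (k has_real_derivative k' x) (at x)"
    and Y: "\<And>x v. x \<in> I \<Longrightarrow> h x * Y (\<phi> x) (k x * v) = k' x * v\<^sup>2 + k x * X x v"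
  shows "transforms_into I h \<phi> X Y"
  unfolding transforms_into_def
proof (intro allI impI)
  fix J x \<tau>
  assume "is_solution X I J x" and \<tau>: "\<forall>t\<in>J. (\<tau> has_real_derivative h (x t)) (at t)"
  then obtain v where J: "open_interval J" and xI: "\<And>t. t \<in> J \<Longrightarrow> x t \<in> I"
    and xd: "\<And>t. t \<in> J \<Longrightarrow> (x has_real_derivative v t) (at t)"
    and vd: "\<And>t. t \<in> J \<Longrightarrow> (v has_real_derivative X (x t) (v t)) (at t)"
    unfolding is_solution_def by blast
  have nz: "h (x t) \<noteq> 0" if "t \<in> J" for t
    using h xI that by blast
  have inj: "inj_on \<tau> J"
    using inj_on_nonzero_deriv[OF J, of \<tau> "\<lambda>t. h (x t)"] \<tau> nz by blast
  have cont: "continuous_on J \<tau>"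
    using \<tau> by (intro continuous_at_imp_continuous_on ballI) (blast intro: DERIV_isCont)
  let ?s = "the_inv_into J \<tau>"
  have s: "?s (\<tau> t) = t" if "t \<in> J" for t
    by (rule the_inv_into_f_f[OF inj that])
  have sd: "(?s has_real_derivative inverse (h (x t))) (at (\<tau> t))" if "t \<in> J" for t
    using the_inv_into_has_real_derivative[OF J, of \<tau> "\<lambda>t. h (x t)"] \<tau> nz that by blast
  \<comment> \<open>The new velocity dy/d\<tau>, expressed in the old time.\<close>
  let ?w = "\<lambda>t. k (x t) * v t"
  have yd: "((\<lambda>t. \<phi> (x t)) has_real_derivative h (x t) * ?w t) (at t)" if "t \<in> J" for t
    using DERIV_chain2[OF \<phi>[OF xI[OF that]] xd[OF that]] by (simp add: mult.assoc)
  have wd: "(?w has_real_derivative h (x t) * Y (\<phi> (x t)) (?w t)) (at t)" if "t \<in> J" for t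
  proof -
    have "((\<lambda>t. k (x t)) has_real_derivative k' (x t) * v t) (at t)"
      by (intro DERIV_chain2[of k] k xI xd that)
    from DERIV_mult[OF this vd[OF that]] show ?thesis
      using Y[OF xI[OF that], of "v t"] by (simp add: power2_eq_square algebra_simps)
  qed
  \<comment> \<open>Change of time: since dt/d\<tau> = 1/h, a t-derivative of the form
    \<open>h * D\<close> becomes the \<tau>-derivative \<open>D\<close>.\<close>
  have sub: "((\<lambda>r. f (?s r)) has_real_derivative D) (at (\<tau> t))"
    if t: "t \<in> J" and f: "(f has_real_derivative h (x t) * D) (at t)" for f D t
    using DERIV_chain2[of f, OF _ sd[OF t]] f nz[OF t] by (force simp: s[OF t] field_simps)
  have "((\<lambda>r. \<phi> (x (?s r))) has_real_derivative ?w t) (at (\<tau> t)) \<and>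
      ((\<lambda>r. ?w (?s r)) has_real_derivative Y (\<phi> (x t)) (?w t)) (at (\<tau> t))" if t: "t \<in> J" for t
    using sub[OF t yd[OF t]] sub[OF t wd[OF t]] by blast
  then have "\<exists>w. \<forall>r\<in>\<tau> ` J. ((\<lambda>r. \<phi> (x (?s r))) has_real_derivative w r) (at r) \<and>
      (w has_real_derivative Y (\<phi> (x (?s r))) (w r)) (at r)"
    by (intro exI[of _ "\<lambda>r. ?w (?s r)"]) (auto simp: s)
  then show "is_solution Y (\<phi> ` I) (\<tau> ` J) (\<lambda>r. \<phi> (x (?s r)))"
    unfolding is_solution_def using open_interval_image[OF J cont inj] xI s by auto
qed

text \<open>Tests the transformation on the local solution with data \<open>(x0, v0)\<close> and
  differentiates the new velocity at time 0 in two ways.\<close>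

lemma transforms_intoD:
  assumes I: "open_interval I" and X: "smooth_on (I \<times> UNIV) (\<lambda>(x, v). X x v)"
    and tr: "transforms_into I h \<phi> X Y"
    and h: "continuous_on I h" "\<And>x. x \<in> I \<Longrightarrow> h x \<noteq> 0"
    and \<phi>: "\<And>x. x \<in> I \<Longrightarrow> (\<phi> has_real_derivative h x * k x) (at x)"
    and k: "\<And>x. x \<in> I \<Longrightarrow> (k has_real_derivative k' x) (at x)"
    and x0: "x0 \<in> I"
  shows "h x0 * Y (\<phi> x0) (k x0 * v0) = k' x0 * v0\<^sup>2 + k x0 * X x0 v0"
proof -
  obtain J x v where J: "open_interval J" "0 \<in> J" and 0: "x 0 = x0" "v 0 = v0"
    and "\<forall>t\<in>J. x t \<in> I \<and> (x has_real_derivative v t) (at t) \<and>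
      (v has_real_derivative X (x t) (v t)) (at t)"
    by (rule local_solution[OF I X x0, of v0])
  then have sol: "x t \<in> I \<and> (x has_real_derivative v t) (at t) \<and>
      (v has_real_derivative X (x t) (v t)) (at t)" if "t \<in> J" for t
    using that by blast
  have opJ: "open J"
    using J by (simp add: open_interval_def)
  have "continuous_on J x"
    using sol by (intro continuous_at_imp_continuous_on ballI) (blast intro: DERIV_isCont)
  then have "continuous_on J (\<lambda>t. h (x t))"
    by (rule continuous_on_compose2[OF h(1)]) (use sol in auto)
  \<comment> \<open>The transformation property speaks only of a curve together with a new time, so
    a primitive of \<open>h\<close> along the curve has to be produced.\<close>
  then obtain \<tau> where \<tau>: "\<And>t. t \<in> J \<Longrightarrow> (\<tau> has_real_derivative h (x t)) (at t)"
    using primitive_on_exists[OF J(1)] unfolding primitive_on_def by blast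
  have "is_solution X I J x"
    unfolding is_solution_def using J sol by blast
  then have "is_solution Y (\<phi> ` I) (\<tau> ` J) (\<lambda>s. \<phi> (x (the_inv_into J \<tau> s)))"
    using tr \<tau> unfolding transforms_into_def by blast
  then obtain w where
    w: "\<And>t. t \<in> J \<Longrightarrow> ((\<lambda>s. \<phi> (x (the_inv_into J \<tau> s))) has_real_derivative w (\<tau> t)) (at (\<tau> t))"
      "\<And>t. t \<in> J \<Longrightarrow>
        (w has_real_derivative Y (\<phi> (x (the_inv_into J \<tau> (\<tau> t)))) (w (\<tau> t))) (at (\<tau> t))"
    unfolding is_solution_def by blast
  have "inj_on \<tau> J"
    by (rule inj_on_nonzero_deriv[OF J(1) \<tau>]) (use sol h in auto)
  then have inv: "the_inv_into J \<tau> (\<tau> t) = t" if "t \<in> J" for t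
    using that the_inv_into_f_f by fastforce
  \<comment> \<open>\<open>is_solution\<close> gives an unspecified velocity \<open>w\<close>;
    differentiating \<open>y(\<tau>(t)) = \<phi>(x(t))\<close> identifies it, after division by
    \<open>h\<close>.\<close>
  have w_eq: "w (\<tau> t) = k (x t) * v t" if t: "t \<in> J" for t
  proof -
    have "((\<lambda>t. \<phi> (x t)) has_real_derivative w (\<tau> t) * h (x t)) (at t)"
      by (rule has_field_derivative_transform_within_open[OF DERIV_chain2[OF w(1)[OF t] \<tau>[OF t]] opJ t])
        (simp add: inv)
    moreover have "((\<lambda>t. \<phi> (x t)) has_real_derivative h (x t) * k (x t) * v t) (at t)"
      using sol[OF t] by (intro DERIV_chain2[of \<phi>] \<phi>) auto
    ultimately have "w (\<tau> t) * h (x t) = h (x t) * k (x t) * v t"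
      by (rule DERIV_unique)
    then show ?thesis
      using h(2) sol[OF t] by simp
  qed
  have "((\<lambda>t. w (\<tau> t)) has_real_derivative Y (\<phi> x0) (k x0 * v0) * h x0) (at 0)"
    using DERIV_chain2[OF w(2)[OF J(2)] \<tau>[OF J(2)]] by (simp add: inv[OF J(2)] w_eq[OF J(2)] 0)
  then have "((\<lambda>t. k (x t) * v t) has_real_derivative Y (\<phi> x0) (k x0 * v0) * h x0) (at 0)"
    by (rule has_field_derivative_transform_within_open[OF _ opJ J(2)]) (rule w_eq)
  moreover have "((\<lambda>t. k (x t) * v t) has_real_derivative k' x0 * v0 * v0 + X x0 v0 * k x0) (at 0)"
  proof -
    have "((\<lambda>t. k (x t)) has_real_derivative k' (x 0) * v 0) (at 0)"
      using sol[OF J(2)] by (intro DERIV_chain2[of k] k) auto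
    then show ?thesis
      using DERIV_mult[of "\<lambda>t. k (x t)" _ 0 UNIV v] sol[OF J(2)] 0 by simp
  qed
  ultimately have "Y (\<phi> x0) (k x0 * v0) * h x0 = k' x0 * v0 * v0 + X x0 v0 * k x0"
    by (rule DERIV_unique)
  then show ?thesis
    by (simp add: power2_eq_square algebra_simps)
qed

lemma zero_deriv_constant:
  fixes f :: "real \<Rightarrow> real"
  assumes I: "open_interval I" and f: "\<And>x. x \<in> I \<Longrightarrow> (f has_real_derivative 0) (at x)"
  obtains c where "\<And>x. x \<in> I \<Longrightarrow> f x = c"
proof -
  have "convex I"
    using I by (simp add: open_interval_def is_interval_convex_1)
  then obtain c where "\<And>x. x \<in> I \<Longrightarrow> f x = c"
    using has_field_derivative_zero_constant[of I f] f has_field_derivative_at_within by metis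
  then show thesis
    by (rule that)
qed

section \<open>The form forced on the equation by a transformation\<close>

lemma gen_sundman_factor:
  assumes I: "open_interval I" and gs: "gen_sundman I h \<phi>"
  defines "k \<equiv> \<lambda>x. deriv \<phi> x / h x"
  shows "smooth_on I k" "\<And>x. x \<in> I \<Longrightarrow> k x \<noteq> 0"
    "\<And>x. x \<in> I \<Longrightarrow> (\<phi> has_real_derivative h x * k x) (at x)"
proof -
  have op: "open I" and h: "smooth_on I h" "\<And>x. x \<in> I \<Longrightarrow> h x \<noteq> 0"
    and \<phi>: "smooth_diffeo I \<phi>" "smooth_on I \<phi>"
    using I gs by (auto simp: open_interval_def gen_sundman_def smooth_diffeo_def)
  show "smooth_on I k"
    unfolding k_def by (rule smooth_on_divide[OF op smooth_on_deriv(2)[OF op \<phi>(2)] h])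
  fix x assume x: "x \<in> I"
  show "k x \<noteq> 0"
    using smooth_diffeo_deriv_nonzero[OF I \<phi>(1) x] h(2)[OF x] by (simp add: k_def)
  show "(\<phi> has_real_derivative h x * k x) (at x)"
    using smooth_on_deriv(1)[OF op \<phi>(2) x] h(2)[OF x] by (simp add: k_def)
qed

text \<open>Solves the identity for \<open>X x v\<close> by dividing by the nonvanishing
  \<open>k\<close>.\<close>

lemma has_form_if_transforms_into:
  assumes I: "open_interval I" and X: "smooth_on (I \<times> UNIV) (\<lambda>(x, v). X x v)"
    and gs: "gen_sundman I h \<phi>" and AB: "smooth_on (\<phi> ` I) \<A>" "smooth_on (\<phi> ` I) \<B>"
    and tr: "transforms_into I h \<phi> X (\<lambda>y w. - (\<A> y * w + \<B> y))"
  defines "k \<equiv> \<lambda>x. deriv \<phi> x / h x"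
  shows "has_form I X (\<lambda>x. deriv k x / k x) (\<lambda>x. h x * \<A> (\<phi> x)) (\<lambda>x. h x * \<B> (\<phi> x) / k x)"
proof -
  have k: "smooth_on I k" "\<And>x. x \<in> I \<Longrightarrow> k x \<noteq> 0"
    "\<And>x. x \<in> I \<Longrightarrow> (\<phi> has_real_derivative h x * k x) (at x)"
    using gen_sundman_factor[OF I gs] unfolding k_def by blast+
  have op: "open I" "open (\<phi> ` I)" and h: "smooth_on I h" "\<And>x. x \<in> I \<Longrightarrow> h x \<noteq> 0"
    and \<phi>: "smooth_on I \<phi>"
    using I gs by (auto simp: open_interval_def gen_sundman_def smooth_diffeo_def)
  have AB\<phi>: "smooth_on I (\<lambda>x. \<A> (\<phi> x))" "smooth_on I (\<lambda>x. \<B> (\<phi> x))"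
    using smooth_on_compose[OF op _ \<phi>] AB by auto
  have "X x v = - (deriv k x / k x * v\<^sup>2 + h x * \<A> (\<phi> x) * v + h x * \<B> (\<phi> x) / k x)"
    if x: "x \<in> I" for x v
    using transforms_intoD[OF I X tr smooth_on_continuous[OF op(1) h(1)] h(2) k(3)
        smooth_on_deriv(1)[OF op(1) k(1)] x, of v] k(2)[OF x]
    by (simp add: field_simps)
  then show ?thesis
    unfolding has_form_def
    by (intro conjI ballI allI smooth_on_divide[OF op(1)] smooth_on_mult[OF op(1)]
        smooth_on_deriv(2)[OF op(1)] k(1,2) h(1) AB\<phi>)
qed

section \<open>Transformations built from a primitive of \<gamma>\<close>

lemma transforms_into_if_has_form:
  assumes form: "has_form I X \<gamma> A b" and \<Gamma>: "primitive_on I \<gamma> \<Gamma>"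
    and h: "\<And>x. x \<in> I \<Longrightarrow> h x \<noteq> 0"
    and \<phi>: "\<And>x. x \<in> I \<Longrightarrow> (\<phi> has_real_derivative h x * (s * exp (\<Gamma> x))) (at x)"
    and Y: "\<And>x v. x \<in> I \<Longrightarrow> h x * Y (\<phi> x) (s * exp (\<Gamma> x) * v) = - (s * exp (\<Gamma> x) * (A x * v + b x))"
  shows "transforms_into I h \<phi> X Y"
proof (rule transforms_intoI[OF h \<phi>])
  fix x assume x: "x \<in> I"
  \<comment> \<open>With \<open>k = s * exp \<Gamma>\<close> one has \<open>k' = \<gamma> k\<close>,
    so the quadratic terms of \<open>k' v^2 + k X\<close> cancel and only
    \<open>- k (A v + b)\<close> is left, as assumed of \<open>h Y\<close>.\<close>
  show "((\<lambda>x. s * exp (\<Gamma> x)) has_real_derivative s * exp (\<Gamma> x) * \<gamma> x) (at x)"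
    using \<Gamma> x by (auto simp: primitive_on_def intro!: derivative_eq_intros)
  show "h x * Y (\<phi> x) (s * exp (\<Gamma> x) * v) = s * exp (\<Gamma> x) * \<gamma> x * v\<^sup>2 + s * exp (\<Gamma> x) * X x v" for v
  proof -
    have Xv: "X x v = - (\<gamma> x * v\<^sup>2 + A x * v + b x)"
      using form x by (simp add: has_form_def)
    show ?thesis
      unfolding Y[OF x] Xv by (simp add: algebra_simps)
  qed
qed

lemma primitive_on_smooth:
  assumes "open S" "smooth_on S f" "primitive_on S f F"
  shows "smooth_on S F"
  using assms by (intro smooth_on_derivI[of S F f]) (auto simp: primitive_on_def)

text \<open>The sign is constant, so the absolute value is a constant multiple of \<open>f\<close>.
  This makes \<bar>A\<bar> and \<bar>b\<bar> admissible factors of \<open>h\<close>.\<close>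

lemma smooth_on_abs:
  assumes I: "open_interval I" and f: "smooth_on I f" and nz: "nowhere_zero_on I f"
  shows "smooth_on I (\<lambda>x. \<bar>f x\<bar>)"
proof -
  have op: "open I"
    using I by (simp add: open_interval_def)
  obtain s where s: "\<And>x. x \<in> I \<Longrightarrow> sgn (f x) = s"
    using constant_sgn[OF I smooth_on_continuous[OF op f]] nz unfolding nowhere_zero_on_def by metis
  have "smooth_on I (\<lambda>x. s * f x)"
    by (intro smooth_on_mult[OF op] smooth_on_const op f)
  moreover have "\<bar>f x\<bar> = s * f x" if "x \<in> I" for x
    using s[OF that] by (auto simp: abs_sgn mult.commute)
  ultimately show ?thesis
    using smooth_on_cong[OF op, of "\<lambda>x. \<bar>f x\<bar>" "\<lambda>x. s * f x"] by simp
qed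

lemma gen_sundman_identity:
  assumes I: "open_interval I" and form: "has_form I X \<gamma> A b" and \<Gamma>: "primitive_on I \<gamma> \<Gamma>"
  shows "gen_sundman I (\<lambda>x. exp (- \<Gamma> x)) (\<lambda>x. x)"
proof -
  have op: "open I"
    using I by (simp add: open_interval_def)
  have "smooth_on I \<gamma>"
    using form by (simp add: has_form_def)
  from primitive_on_smooth[OF op this \<Gamma>] have "smooth_on I (\<lambda>x. exp (- \<Gamma> x))"
    by (intro smooth_on_exp smooth_on_minus op)
  moreover have "smooth_diffeo I (\<lambda>x. x)"
    by (rule smooth_diffeo_deriv[OF I, of _ "\<lambda>x. 1"]) (auto intro: smooth_on_const op)
  ultimately show ?thesis
    by (simp add: gen_sundman_def)
qed

text \<open>The choice \<open>\<phi> = id\<close> forces \<open>h k = 1\<close>, hence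
  \<open>h = exp (- \<Gamma>)\<close> for \<open>k = exp \<Gamma>\<close>; the condition on
  \<open>Y\<close> is the identity divided by \<open>h\<close>.\<close>

lemma transforms_into_identity:
  assumes "has_form I X \<gamma> A b" "primitive_on I \<gamma> \<Gamma>"
    and "\<And>x v. x \<in> I \<Longrightarrow> Y x (exp (\<Gamma> x) * v) = - ((exp (\<Gamma> x))\<^sup>2 * (A x * v + b x))"
  shows "transforms_into I (\<lambda>x. exp (- \<Gamma> x)) (\<lambda>x. x) X Y"
proof (rule transforms_into_if_has_form[OF assms(1,2), where s = 1])
  show "((\<lambda>x. x) has_real_derivative exp (- \<Gamma> x) * (1 * exp (\<Gamma> x))) (at x)" for x
    by (simp flip: exp_add)
qed (simp_all add: assms(3) exp_minus power2_eq_square)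

text \<open>A change of time alone removes the quadratic term, leaving
  \<open>exp \<Gamma> * A\<close> and \<open>exp (2 \<Gamma>) * b\<close> as the
  coefficients.\<close>

lemma fibre_linearisable_if_has_form:
  assumes I: "open_interval I" and form: "has_form I X \<gamma> A b"
  shows "fibre_linearisable I X"
proof -
  have op: "open I"
    using I by (simp add: open_interval_def)
  have sm: "smooth_on I \<gamma>" "smooth_on I A" "smooth_on I b"
    using form by (auto simp: has_form_def)
  obtain \<Gamma> where \<Gamma>: "primitive_on I \<gamma> \<Gamma>"
    using primitive_on_exists[OF I smooth_on_continuous[OF op sm(1)]] by blast
  have e: "smooth_on I (\<lambda>x. exp (\<Gamma> x))"
    by (rule smooth_on_exp[OF op primitive_on_smooth[OF op sm(1) \<Gamma>]])
  have "transforms_into I (\<lambda>x. exp (- \<Gamma> x)) (\<lambda>x. x) X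
      (\<lambda>y w. - (exp (\<Gamma> y) * A y * w + exp (\<Gamma> y) * exp (\<Gamma> y) * b y))"
    by (rule transforms_into_identity[OF form \<Gamma>]) (simp add: power2_eq_square algebra_simps)
  moreover have "smooth_on ((\<lambda>x. x) ` I) (\<lambda>y. exp (\<Gamma> y) * A y)"
    "smooth_on ((\<lambda>x. x) ` I) (\<lambda>y. exp (\<Gamma> y) * exp (\<Gamma> y) * b y)"
    unfolding image_ident by (intro smooth_on_mult[OF op] e sm)+
  moreover note gen_sundman_identity[OF I form \<Gamma>]
  ultimately show ?thesis
    unfolding fibre_linearisable_def by blast
qed

lemma gen_sundman_abs:
  assumes I: "open_interval I" and form: "has_form I X \<gamma> A b" and \<Gamma>: "primitive_on I \<gamma> \<Gamma>"
    and A: "nowhere_zero_on I A" and \<phi>: "primitive_on I (\<lambda>x. A x * exp (\<Gamma> x)) \<phi>"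
  shows "gen_sundman I (\<lambda>x. \<bar>A x\<bar>) \<phi>"
proof -
  have op: "open I"
    using I by (simp add: open_interval_def)
  have sm: "smooth_on I \<gamma>" "smooth_on I A" "smooth_on I b"
    using form by (auto simp: has_form_def)
  have "smooth_on I (\<lambda>x. A x * exp (\<Gamma> x))"
    by (intro smooth_on_mult[OF op] smooth_on_exp[OF op] primitive_on_smooth[OF op _ \<Gamma>] sm)
  then have "smooth_diffeo I \<phi>"
    using \<phi> A smooth_diffeo_deriv[OF I, of \<phi> "\<lambda>x. A x * exp (\<Gamma> x)"]
    by (simp add: primitive_on_def nowhere_zero_on_def)
  then show ?thesis
    using smooth_on_abs[OF I sm(2) A] A by (simp add: gen_sundman_def nowhere_zero_on_def)
qed

text \<open>With \<open>h = s A\<close> and \<open>k = s exp \<Gamma>\<close> one gets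
  \<open>\<phi>' = h k = A exp \<Gamma>\<close>, damping \<open>A / h = s\<close> and restoring term
  \<open>b k / h\<close>. The latter is prescribed along \<phi> only, which suits both a general and
  an affine \<beta>.\<close>

lemma transforms_into_abs:
  assumes form: "has_form I X \<gamma> A b" and \<Gamma>: "primitive_on I \<gamma> \<Gamma>"
    and s: "s = 1 \<or> s = -1" "\<And>x. x \<in> I \<Longrightarrow> sgn (A x) = s"
    and \<phi>: "primitive_on I (\<lambda>x. A x * exp (\<Gamma> x)) \<phi>"
    and \<beta>: "\<And>x. x \<in> I \<Longrightarrow> \<beta> (\<phi> x) = b x * exp (\<Gamma> x) / A x"
  shows "transforms_into I (\<lambda>x. \<bar>A x\<bar>) \<phi> X (\<lambda>y w. - (s * w + \<beta> y))"
proof (rule transforms_into_if_has_form[OF form \<Gamma>, where s = s])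
  fix x assume x: "x \<in> I"
  have abs: "\<bar>A x\<bar> = A x * s" and ss: "s * s = 1" and nz: "A x \<noteq> 0"
    using s(1) s(2)[OF x] abs_sgn[of "A x"] by auto
  show "\<bar>A x\<bar> \<noteq> 0" using nz by simp
  have "\<bar>A x\<bar> * (s * exp (\<Gamma> x)) = (s * s) * (A x * exp (\<Gamma> x))"
    unfolding abs by (simp only: ac_simps)
  also have "\<dots> = A x * exp (\<Gamma> x)"
    by (simp only: ss mult_1)
  finally show "(\<phi> has_real_derivative \<bar>A x\<bar> * (s * exp (\<Gamma> x))) (at x)"
    using \<phi> x by (simp only: primitive_on_def)
  show "\<bar>A x\<bar> * - (s * (s * exp (\<Gamma> x) * v) + \<beta> (\<phi> x)) = - (s * exp (\<Gamma> x) * (A x * v + b x))" for v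
  proof -
    have "\<bar>A x\<bar> * - (s * (s * exp (\<Gamma> x) * v) + \<beta> (\<phi> x)) =
        - (s * exp (\<Gamma> x) * ((s * s) * A x * v + b x))"
      using nz by (simp add: abs \<beta>[OF x] field_simps)
    then show ?thesis
      by (simp add: ss)
  qed
qed

lemma constant_damping:
  assumes I: "open_interval I" and form: "has_form I X \<gamma> A b"
    and A: "zero_on I A \<or> nowhere_zero_on I A"
  shows "\<exists>\<alpha>\<in>{-1, 0, 1}. (\<forall>x\<in>I. sgn (A x) = \<alpha>) \<and>
    (\<exists>h \<phi> \<beta>. gen_sundman I h \<phi> \<and> smooth_on (\<phi> ` I) \<beta> \<and>
      transforms_into I h \<phi> X (\<lambda>y w. - (\<alpha> * w + \<beta> y)))"
proof -
  have op: "open I"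
    using I by (simp add: open_interval_def)
  have sm: "smooth_on I \<gamma>" "smooth_on I A" "smooth_on I b"
    using form by (auto simp: has_form_def)
  obtain \<Gamma> where \<Gamma>: "primitive_on I \<gamma> \<Gamma>"
    using primitive_on_exists[OF I smooth_on_continuous[OF op sm(1)]] by blast
  have e: "smooth_on I (\<lambda>x. exp (\<Gamma> x))"
    by (rule smooth_on_exp[OF op primitive_on_smooth[OF op sm(1) \<Gamma>]])
  show ?thesis
    using A
  proof
    assume z: "zero_on I A"
    \<comment> \<open>With \<open>A = 0\<close> there is no damping to normalise, and the change of
      time alone suffices.\<close>
    have "transforms_into I (\<lambda>x. exp (- \<Gamma> x)) (\<lambda>x. x) X
        (\<lambda>y w. - (0 * w + exp (\<Gamma> y) * exp (\<Gamma> y) * b y))"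
      using z by (intro transforms_into_identity[OF form \<Gamma>])
        (simp add: power2_eq_square zero_on_def)
    moreover have "smooth_on ((\<lambda>x. x) ` I) (\<lambda>y. exp (\<Gamma> y) * exp (\<Gamma> y) * b y)"
      unfolding image_ident by (intro smooth_on_mult[OF op] e sm)
    moreover note gen_sundman_identity[OF I form \<Gamma>]
    moreover have "\<forall>x\<in>I. sgn (A x) = 0"
      using z by (simp add: zero_on_def)
    ultimately show ?thesis
      by (intro bexI[of _ 0]) blast+
  next
    assume nz: "nowhere_zero_on I A"
    obtain s where s: "s = 1 \<or> s = -1" "\<And>x. x \<in> I \<Longrightarrow> sgn (A x) = s"
      using constant_sgn[OF I smooth_on_continuous[OF op sm(2)]] nz unfolding nowhere_zero_on_def by metis
    obtain \<phi> where \<phi>: "primitive_on I (\<lambda>x. A x * exp (\<Gamma> x)) \<phi>"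
      using primitive_on_exists[OF I smooth_on_continuous[OF op smooth_on_mult[OF op sm(2) e]]] by blast
    have gs: "gen_sundman I (\<lambda>x. \<bar>A x\<bar>) \<phi>"
      by (rule gen_sundman_abs[OF I form \<Gamma> nz \<phi>])
    then have inv: "smooth_on (\<phi> ` I) (the_inv_into I \<phi>)" "open (\<phi> ` I)" "inj_on \<phi> I"
      by (auto simp: gen_sundman_def smooth_diffeo_def open_interval_def)
    \<comment> \<open>The value prescribed along \<phi> is moved to the image of \<phi> by the
      smooth inverse.\<close>
    let ?\<beta> = "\<lambda>y. (\<lambda>x. b x * exp (\<Gamma> x) / A x) (the_inv_into I \<phi> y)"
    have "smooth_on I (\<lambda>x. b x * exp (\<Gamma> x) / A x)"
      using nz by (intro smooth_on_divide[OF op] smooth_on_mult[OF op] sm e)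
        (simp add: nowhere_zero_on_def)
    then have "smooth_on (\<phi> ` I) ?\<beta>"
      using the_inv_into_f_f[OF inv(3)] by (intro smooth_on_compose[OF inv(2) op _ inv(1)]) auto
    moreover have "transforms_into I (\<lambda>x. \<bar>A x\<bar>) \<phi> X (\<lambda>y w. - (s * w + ?\<beta> y))"
      by (rule transforms_into_abs[OF form \<Gamma> s \<phi>]) (simp_all add: the_inv_into_f_f[OF inv(3)])
    moreover note gs
    moreover have "s \<in> {-1, 0, 1}" "\<forall>x\<in>I. sgn (A x) = s"
      using s by auto
    ultimately show ?thesis
      by blast
  qed
qed

section \<open>The condition \<open>Q_lin = 0\<close>\<close>

lemma inner_op_smooth:
  assumes "open S" "smooth_on S \<gamma>" "smooth_on S A" "smooth_on S b"
  shows "smooth_on S (inner_op \<gamma> A b)"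
proof -
  have "smooth_on S (\<lambda>x. A x * deriv b x + \<gamma> x * A x * b x + - (deriv A x * b x))"
    by (intro smooth_on_add smooth_on_minus smooth_on_mult smooth_on_deriv(2) assms)
  then show ?thesis
    by (simp add: inner_op_def)
qed

text \<open>The coefficients are those of \<open>has_form_if_transforms_into\<close> for a constant
  \<open>\<A>\<close> and an affine \<open>\<B>\<close>. The inner operator gives
  \<open>\<alpha> * B * h^3\<close>, and the outer one, with \<open>A = \<alpha> h\<close>,
  annihilates \<open>h^3\<close>.\<close>

lemma Q_lin_zero_if_linear:
  assumes S: "open S" and h: "smooth_on S h"
    and \<phi>: "\<And>x. x \<in> S \<Longrightarrow> (\<phi> has_real_derivative h x * k x) (at x)"
    and k: "smooth_on S k" "\<And>x. x \<in> S \<Longrightarrow> k x \<noteq> 0" and x: "x \<in> S"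
  shows "Q_lin (\<lambda>x. deriv k x / k x) (\<lambda>x. h x * \<alpha>) (\<lambda>x. h x * (B * \<phi> x + C) / k x) x = 0"
proof -
  let ?A = "\<lambda>x. h x * \<alpha>" and ?b = "\<lambda>x. h x * (B * \<phi> x + C) / k x"
  let ?g = "inner_op (\<lambda>x. deriv k x / k x) ?A ?b"
  note hd = smooth_on_deriv(1)[OF S h] and kd = smooth_on_deriv(1)[OF S k(1)]
  have dA: "deriv ?A y = deriv h y * \<alpha>" if "y \<in> S" for y
    by (rule DERIV_imp_deriv) (auto intro!: derivative_eq_intros hd that)
  have inner: "?g y = \<alpha> * B * h y ^ 3" if y: "y \<in> S" for y
  proof -
    have "(?b has_real_derivative ((deriv h y * (B * \<phi> y + C) + h y * (B * (h y * k y))) * k y -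
        h y * (B * \<phi> y + C) * deriv k y) / (k y * k y)) (at y)"
      using k(2)[OF y] by (auto intro!: derivative_eq_intros hd kd \<phi> y simp: algebra_simps)
    then have db: "deriv ?b y = ((deriv h y * (B * \<phi> y + C) + h y * (B * (h y * k y))) * k y -
        h y * (B * \<phi> y + C) * deriv k y) / (k y * k y)"
      by (rule DERIV_imp_deriv)
    show ?thesis
      using k(2)[OF y] unfolding inner_op_def dA[OF y] db
      by (simp add: field_simps power3_eq_cube)
  qed
  have "(?g has_real_derivative \<alpha> * B * (3 * h x ^ 2 * deriv h x)) (at x)"
    by (rule has_field_derivative_transform_within_open[OF _ S x, of "\<lambda>y. \<alpha> * B * h y ^ 3"])
      (auto intro!: derivative_eq_intros hd x simp: inner)
  then have "deriv ?g x = \<alpha> * B * (3 * h x ^ 2 * deriv h x)"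
    by (rule DERIV_imp_deriv)
  then show ?thesis
    by (simp add: Q_lin_def outer_op_def dA[OF x] inner[OF x] power2_eq_square power3_eq_cube)
qed

text \<open>The equation \<open>A g' = 3 A' g\<close> for \<open>g = A b' + \<gamma> A b - A' b\<close> integrates to \<open>g = B A\<^sup>3\<close>, and
  \<open>(b e\<^sup>\<Gamma> / A)' = e\<^sup>\<Gamma> g / A\<^sup>2 = B A e\<^sup>\<Gamma>\<close>.\<close>

lemma affine_if_Q_lin_zero:
  assumes I: "open_interval I" and form: "has_form I X \<gamma> A b" and \<Gamma>: "primitive_on I \<gamma> \<Gamma>"
    and A: "nowhere_zero_on I A" and \<phi>: "primitive_on I (\<lambda>x. A x * exp (\<Gamma> x)) \<phi>"
    and Q: "\<And>x. x \<in> I \<Longrightarrow> Q_lin \<gamma> A b x = 0"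
  obtains B C where "\<And>x. x \<in> I \<Longrightarrow> B * \<phi> x + C = b x * exp (\<Gamma> x) / A x"
proof -
  have op: "open I"
    using I by (simp add: open_interval_def)
  have sm: "smooth_on I \<gamma>" "smooth_on I A" "smooth_on I b"
    using form by (auto simp: has_form_def)
  have nz: "A x \<noteq> 0" if "x \<in> I" for x
    using A that by (simp add: nowhere_zero_on_def)
  let ?g = "inner_op \<gamma> A b"
  note Ad = smooth_on_deriv(1)[OF op sm(2)] and bd = smooth_on_deriv(1)[OF op sm(3)]
    and gd = smooth_on_deriv(1)[OF op inner_op_smooth[OF op sm]]
  have "((\<lambda>x. ?g x / A x ^ 3) has_real_derivative 0) (at x)" if x: "x \<in> I" for x
  proof -
    have "((\<lambda>x. ?g x / A x ^ 3) has_real_derivative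
        (deriv ?g x * A x ^ 3 - ?g x * (3 * A x ^ 2 * deriv A x)) / (A x ^ 3 * A x ^ 3)) (at x)"
      using nz[OF x] by (auto intro!: derivative_eq_intros gd Ad x)
    moreover have "deriv ?g x * A x ^ 3 - ?g x * (3 * A x ^ 2 * deriv A x) = A x ^ 2 * Q_lin \<gamma> A b x"
      by (simp add: Q_lin_def outer_op_def power2_eq_square power3_eq_cube algebra_simps)
    ultimately show ?thesis
      using Q[OF x] by simp
  qed
  then obtain B where "\<And>x. x \<in> I \<Longrightarrow> ?g x / A x ^ 3 = B"
    using zero_deriv_constant[OF I] by blast
  then have g: "?g x = B * A x ^ 3" if "x \<in> I" for x
    using that nz by (force simp: field_simps)
  have "((\<lambda>x. b x * exp (\<Gamma> x) / A x - B * \<phi> x) has_real_derivative 0) (at x)" if x: "x \<in> I" for x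
  proof -
    have "((\<lambda>x. b x * exp (\<Gamma> x) / A x - B * \<phi> x) has_real_derivative
        ((deriv b x * exp (\<Gamma> x) + b x * (exp (\<Gamma> x) * \<gamma> x)) * A x - b x * exp (\<Gamma> x) * deriv A x) /
          (A x * A x) - B * (A x * exp (\<Gamma> x))) (at x)"
      using nz[OF x] \<Gamma> \<phi> x
      by (auto intro!: derivative_eq_intros bd Ad simp: primitive_on_def algebra_simps)
    moreover have "(deriv b x * exp (\<Gamma> x) + b x * (exp (\<Gamma> x) * \<gamma> x)) * A x - b x * exp (\<Gamma> x) * deriv A x =
        exp (\<Gamma> x) * ?g x"
      by (simp add: inner_op_def algebra_simps)
    ultimately show ?thesis
      using nz[OF x] by (simp add: g[OF x] power3_eq_cube)
  qed
  then obtain C where C: "\<And>x. x \<in> I \<Longrightarrow> b x * exp (\<Gamma> x) / A x - B * \<phi> x = C"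
    using zero_deriv_constant[OF I] by blast
  show thesis
    by (rule that[of B C]) (use C in \<open>force simp: algebra_simps\<close>)
qed

section \<open>The explicit linearising transformations\<close>

lemma transforms_linear_damped:
  assumes I: "open_interval I" and form: "has_form I X \<gamma> A b" and \<Gamma>: "primitive_on I \<gamma> \<Gamma>"
    and A: "nowhere_zero_on I A" and Q: "\<forall>x\<in>I. Q_lin \<gamma> A b x = 0"
    and \<phi>: "primitive_on I (\<lambda>x. A x * exp (\<Gamma> x)) \<phi>"
  shows "\<exists>\<alpha> B C. (\<forall>x\<in>I. sgn (A x) = \<alpha>) \<and>
    transforms_into I (\<lambda>x. \<bar>A x\<bar>) \<phi> X (\<lambda>y w. - (\<alpha> * w + B * y + C))"
proof -
  have cont: "continuous_on I A"
    using I form smooth_on_continuous by (auto simp: open_interval_def has_form_def)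
  obtain s where s: "s = 1 \<or> s = -1" "\<And>x. x \<in> I \<Longrightarrow> sgn (A x) = s"
    using constant_sgn[OF I cont] A unfolding nowhere_zero_on_def by metis
  obtain B C where BC: "\<And>x. x \<in> I \<Longrightarrow> B * \<phi> x + C = b x * exp (\<Gamma> x) / A x"
    using affine_if_Q_lin_zero[OF I form \<Gamma> A \<phi>] Q by blast
  \<comment> \<open>\<open>BC\<close> says exactly that the restoring term prescribed along \<phi>
    is affine in \<phi>.\<close>
  have "transforms_into I (\<lambda>x. \<bar>A x\<bar>) \<phi> X (\<lambda>y w. - (s * w + (B * y + C)))"
    by (rule transforms_into_abs[OF form \<Gamma> s \<phi>]) (simp_all add: BC)
  then show ?thesis
    using s(2) by (auto simp: add.assoc)
qed

lemma transforms_linear_free: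
  assumes form: "has_form I X \<gamma> A b" and \<Gamma>: "primitive_on I \<gamma> \<Gamma>"
    and z: "zero_on I A" "zero_on I b"
  shows "transforms_into I (\<lambda>x. exp (- \<Gamma> x)) (\<lambda>x. x) X (\<lambda>y w. 0)"
  by (rule transforms_into_identity[OF form \<Gamma>]) (use z in \<open>simp add: zero_on_def\<close>)

text \<open>For \<open>A = 0\<close> and \<open>Y = - 1\<close> the identity reads
  \<open>h = k b\<close>. With \<open>k = s exp \<Gamma>\<close>, \<open>s\<close> the sign of
  \<open>b\<close>, this gives \<open>h = \<bar>b\<bar> exp \<Gamma>\<close> and
  \<open>\<phi>' = h k = b exp (2 \<Gamma>)\<close>.\<close>

lemma transforms_linear_forced:
  assumes I: "open_interval I" and form: "has_form I X \<gamma> A b" and \<Gamma>: "primitive_on I \<gamma> \<Gamma>"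
    and A: "zero_on I A" and b: "nowhere_zero_on I b"
    and \<phi>: "primitive_on I (\<lambda>x. b x * exp (2 * \<Gamma> x)) \<phi>"
  shows "gen_sundman I (\<lambda>x. \<bar>b x\<bar> * exp (\<Gamma> x)) \<phi>"
    and "transforms_into I (\<lambda>x. \<bar>b x\<bar> * exp (\<Gamma> x)) \<phi> X (\<lambda>y w. - 1)"
proof -
  have op: "open I"
    using I by (simp add: open_interval_def)
  have sm: "smooth_on I \<gamma>" "smooth_on I b"
    using form by (auto simp: has_form_def)
  have \<Gamma>': "smooth_on I \<Gamma>"
    by (rule primitive_on_smooth[OF op sm(1) \<Gamma>])
  have nz: "b x \<noteq> 0" if "x \<in> I" for x
    using b that by (simp add: nowhere_zero_on_def)
  have "smooth_on I (\<lambda>x. b x * exp (2 * \<Gamma> x))"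
    by (intro smooth_on_mult[OF op] smooth_on_exp[OF op] smooth_on_const op sm \<Gamma>')
  then have "smooth_diffeo I \<phi>"
    using \<phi> nz smooth_diffeo_deriv[OF I, of \<phi> "\<lambda>x. b x * exp (2 * \<Gamma> x)"]
    by (simp add: primitive_on_def)
  moreover have "smooth_on I (\<lambda>x. \<bar>b x\<bar> * exp (\<Gamma> x))"
    by (intro smooth_on_mult[OF op] smooth_on_exp[OF op] smooth_on_abs I b sm \<Gamma>')
  ultimately show "gen_sundman I (\<lambda>x. \<bar>b x\<bar> * exp (\<Gamma> x)) \<phi>"
    using nz by (simp add: gen_sundman_def)
  obtain s where s: "s = 1 \<or> s = -1" "\<And>x. x \<in> I \<Longrightarrow> sgn (b x) = s"
    using constant_sgn[OF I smooth_on_continuous[OF op sm(2)]] nz by metis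
  show "transforms_into I (\<lambda>x. \<bar>b x\<bar> * exp (\<Gamma> x)) \<phi> X (\<lambda>y w. - 1)"
  proof (rule transforms_into_if_has_form[OF form \<Gamma>, where s = s])
    fix x assume x: "x \<in> I"
    have abs: "\<bar>b x\<bar> = b x * s" and ss: "s * s = 1"
      using s(1) s(2)[OF x] abs_sgn[of "b x"] by auto
    show "\<bar>b x\<bar> * exp (\<Gamma> x) \<noteq> 0" using nz[OF x] by simp
    have "\<bar>b x\<bar> * exp (\<Gamma> x) * (s * exp (\<Gamma> x)) = (s * s) * (b x * exp (2 * \<Gamma> x))"
      unfolding abs exp_double power2_eq_square by (simp only: ac_simps)
    also have "\<dots> = b x * exp (2 * \<Gamma> x)"
      by (simp only: ss mult_1)
    finally show "(\<phi> has_real_derivative \<bar>b x\<bar> * exp (\<Gamma> x) * (s * exp (\<Gamma> x))) (at x)"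
      using \<phi> x by (simp only: primitive_on_def)
    show "\<bar>b x\<bar> * exp (\<Gamma> x) * - 1 = - (s * exp (\<Gamma> x) * (A x * v + b x))" for v
      using A x by (simp add: abs zero_on_def)
  qed
qed

section \<open>Equivalence of linearisability and \<open>Q_lin = 0\<close>\<close>

lemma gs_linearisable_if_Q_lin_zero:
  assumes I: "open_interval I" and form: "has_form I X \<gamma> A b" and Q: "\<forall>x\<in>I. Q_lin \<gamma> A b x = 0"
    and A: "zero_on I A \<or> nowhere_zero_on I A" and b: "zero_on I A \<Longrightarrow> zero_on I b \<or> nowhere_zero_on I b"
  shows "gs_linearisable I X"
proof -
  have op: "open I"
    using I by (simp add: open_interval_def)
  have sm: "smooth_on I \<gamma>" "smooth_on I A" "smooth_on I b"
    using form by (auto simp: has_form_def)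
  obtain \<Gamma> where \<Gamma>: "primitive_on I \<gamma> \<Gamma>"
    using primitive_on_exists[OF I smooth_on_continuous[OF op sm(1)]] by blast
  have \<Gamma>': "smooth_on I \<Gamma>"
    by (rule primitive_on_smooth[OF op sm(1) \<Gamma>])
  \<comment> \<open>The two dichotomies leave three cases, one for each explicit pair
    \<open>(h, \<phi>)\<close>.\<close>
  consider "zero_on I A" "zero_on I b" | "zero_on I A" "nowhere_zero_on I b" | "nowhere_zero_on I A"
    using A b by blast
  then show ?thesis
  proof cases
    case 1
    then have "transforms_into I (\<lambda>x. exp (- \<Gamma> x)) (\<lambda>x. x) X (\<lambda>y w. - (0 * w + 0 * y + 0))"
      using transforms_linear_free[OF form \<Gamma>] by simp
    then show ?thesis
      unfolding gs_linearisable_def using gen_sundman_identity[OF I form \<Gamma>] by blast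
  next
    case 2
    have "smooth_on I (\<lambda>x. b x * exp (2 * \<Gamma> x))"
      by (intro smooth_on_mult[OF op] smooth_on_exp[OF op] smooth_on_const op sm \<Gamma>')
    then obtain \<phi> where \<phi>: "primitive_on I (\<lambda>x. b x * exp (2 * \<Gamma> x)) \<phi>"
      using primitive_on_exists[OF I smooth_on_continuous[OF op]] by blast
    have "transforms_into I (\<lambda>x. \<bar>b x\<bar> * exp (\<Gamma> x)) \<phi> X (\<lambda>y w. - (0 * w + 0 * y + 1))"
      using transforms_linear_forced(2)[OF I form \<Gamma> 2 \<phi>] by simp
    then show ?thesis
      unfolding gs_linearisable_def using transforms_linear_forced(1)[OF I form \<Gamma> 2 \<phi>] by blast
  next
    case 3
    have "smooth_on I (\<lambda>x. A x * exp (\<Gamma> x))"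
      by (intro smooth_on_mult[OF op] smooth_on_exp[OF op] sm \<Gamma>')
    then obtain \<phi> where \<phi>: "primitive_on I (\<lambda>x. A x * exp (\<Gamma> x)) \<phi>"
      using primitive_on_exists[OF I smooth_on_continuous[OF op]] by blast
    show ?thesis
      unfolding gs_linearisable_def
      using gen_sundman_abs[OF I form \<Gamma> 3 \<phi>] transforms_linear_damped[OF I form \<Gamma> 3 Q \<phi>] by blast
  qed
qed

lemma Q_lin_zero_if_gs_linearisable:
  assumes I: "open_interval I" and X: "smooth_on (I \<times> UNIV) (\<lambda>(x, v). X x v)"
    and lin: "gs_linearisable I X"
  shows "\<exists>\<gamma> A b. has_form I X \<gamma> A b \<and> (\<forall>x\<in>I. Q_lin \<gamma> A b x = 0)"
proof -
  obtain h \<phi> \<alpha> B C where gs: "gen_sundman I h \<phi>"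
    and "transforms_into I h \<phi> X (\<lambda>y w. - (\<alpha> * w + B * y + C))"
    using lin unfolding gs_linearisable_def by blast
  \<comment> \<open>Regrouped so that \<open>B * y + C\<close> can serve as the function
    \<open>\<B>\<close> of the fibre-linear form.\<close>
  then have tr: "transforms_into I h \<phi> X (\<lambda>y w. - (\<alpha> * w + (B * y + C)))"
    by (simp add: add.assoc)
  have op: "open I" "open (\<phi> ` I)" and h: "smooth_on I h"
    using I gs by (auto simp: open_interval_def gen_sundman_def smooth_diffeo_def)
  have "smooth_on (\<phi> ` I) (\<lambda>y. \<alpha>)" "smooth_on (\<phi> ` I) (\<lambda>y. B * y + C)"
    by (intro smooth_on_add smooth_on_mult smooth_on_const smooth_on_ident op)+
  note form = has_form_if_transforms_into[OF I X gs this tr]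
  note k = gen_sundman_factor[OF I gs]
  show ?thesis
    using form Q_lin_zero_if_linear[OF op(1) h k(3) k(1,2)] by blast
qed

theorem theorem6p2:
  fixes I :: "real set" and X :: "real \<Rightarrow> real \<Rightarrow> real"
  assumes I: "open_interval I"
    and X: "smooth_on (I \<times> UNIV) (\<lambda>(x, v). X x v)"
  shows
    "(fibre_linearisable I X \<longleftrightarrow> (\<exists>\<gamma> A b. has_form I X \<gamma> A b)) \<and>
     (\<forall>\<gamma> A b. has_form I X \<gamma> A b \<and> (zero_on I A \<or> nowhere_zero_on I A) \<longrightarrow>
        (\<exists>\<alpha>\<in>{-1, 0, 1}. (\<forall>x\<in>I. sgn (A x) = \<alpha>) \<and>
           (\<exists>h \<phi> \<beta>. gen_sundman I h \<phi> \<and> smooth_on (\<phi> ` I) \<beta> \<and>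
              transforms_into I h \<phi> X (\<lambda>y w. - (\<alpha> * w + \<beta> y))))) \<and>
     ((\<forall>\<gamma> A b. has_form I X \<gamma> A b \<longrightarrow>
         (zero_on I A \<or> nowhere_zero_on I A) \<and>
         (zero_on I A \<longrightarrow> zero_on I b \<or> nowhere_zero_on I b)) \<longrightarrow>
      (gs_linearisable I X \<longleftrightarrow>
         (\<exists>\<gamma> A b. has_form I X \<gamma> A b \<and> (\<forall>x\<in>I. Q_lin \<gamma> A b x = 0))) \<and>
      (\<forall>\<gamma> A b \<Gamma>. has_form I X \<gamma> A b \<and> primitive_on I \<gamma> \<Gamma> \<longrightarrow>
         (zero_on I A \<and> zero_on I b \<longrightarrow>
            gen_sundman I (\<lambda>x. exp (- \<Gamma> x)) (\<lambda>x. x) \<and>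
            transforms_into I (\<lambda>x. exp (- \<Gamma> x)) (\<lambda>x. x) X (\<lambda>y w. 0)) \<and>
         (zero_on I A \<and> nowhere_zero_on I b \<longrightarrow>
            (\<forall>\<phi>. primitive_on I (\<lambda>x. b x * exp (2 * \<Gamma> x)) \<phi> \<longrightarrow>
               gen_sundman I (\<lambda>x. \<bar>b x\<bar> * exp (\<Gamma> x)) \<phi> \<and>
               transforms_into I (\<lambda>x. \<bar>b x\<bar> * exp (\<Gamma> x)) \<phi> X (\<lambda>y w. - 1))) \<and>
         (nowhere_zero_on I A \<and> (\<forall>x\<in>I. Q_lin \<gamma> A b x = 0) \<longrightarrow>
            (\<forall>\<phi>. primitive_on I (\<lambda>x. A x * exp (\<Gamma> x)) \<phi> \<longrightarrow>
               gen_sundman I (\<lambda>x. \<bar>A x\<bar>) \<phi> \<and>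
               (\<exists>\<alpha> B C. (\<forall>x\<in>I. sgn (A x) = \<alpha>) \<and>
                  transforms_into I (\<lambda>x. \<bar>A x\<bar>) \<phi> X
                    (\<lambda>y w. - (\<alpha> * w + B * y + C)))))))"
proof (intro conjI impI allI, goal_cases)
  \<comment> \<open>Goals 1 and 2 form part (i), goal 3 is the equivalence in (ii). The pairs 4-5,
    6-7 and 8-9 state admissibility and effect of the transformations for A = b = 0, for A = 0 with
    b nonvanishing, and for A nonvanishing.\<close>
  case 1
  show ?case
    using fibre_linearisable_if_has_form[OF I] has_form_if_transforms_into[OF I X]
    unfolding fibre_linearisable_def by blast
next
  case 2
  then show ?case
    using constant_damping[OF I] by blast
next
  case 3
  then show ?case
    using gs_linearisable_if_Q_lin_zero[OF I] Q_lin_zero_if_gs_linearisable[OF I X] by blast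
next
  case 4
  then show ?case
    using gen_sundman_identity[OF I] by blast
next
  case 5
  then show ?case
    using transforms_linear_free by blast
next
  case 6
  then show ?case
    using transforms_linear_forced(1)[OF I] by blast
next
  case 7
  then show ?case
    using transforms_linear_forced(2)[OF I] by blast
next
  case 8
  then show ?case
    using gen_sundman_abs[OF I] by blast
next
  case 9
  then show ?case
    using transforms_linear_damped[OF I] by blast
qed

end
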